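(* Let $n$ be a positive integer, $\delta=-\frac{1}{2n+1}$, $c=\frac{1-\delta^2}{4}$, $v_1=-\frac{2}{1+\delta}$, $v_2=-\frac{2}{1-\delta}$, and $$H(x,y)=\frac{y\left(1-\frac{xy}{v_1}\right)^n}{\left(1-\frac{xy}{v_2}\right)^{n+1}}.$$ For each $y_0\neq 0$ the solution curve $Y_{y_0}=\{H(x,y)=y_0\}$ of the equation $\frac{dy}{dx}=cxy^3+y^2$ is irreducible. The analytic continuation of the local solution $y(y_0,x)$ at zero along the loop $\omega$ and then several turns around zero transform this local branch to each one of the $n$ remaining branches of $Y_{y_0}$.
   Context: All variables are complex. $H$ is a first integral of $\frac{dy}{dx}=cxy^3+y^2$. $y(y_0,x)$ denotes the solution with $y(y_0,0)=y_0$, given by $H(x,y)=y_0$; its local branch at $x=0$ is regular. Over a generic $x$ near $0$ the curve $Y_{y_0}$ has $n+1$ branches; apart from the regular one through $(0,y_0)$, the other $n$ branches tend to infinity as $x\to0$. For fixed $y_0\ne0$, put $x_0(y_0)=\kappa/y_0$ with $\kappa=-v_2(v_2/v_1)^n$ (this is the only singularity of the solution other than $x=0$). The loop $\omega$ follows the straight segment from $0$ to the singular point $x_0(y_0)$, then goes around this point counter-clockwise along a small circle, and then returns to $0$ along the same straight segment. "Turns around zero" means continuation along small circles around $x=0$ (starting from the end of $\omega$ at a point close to $0$). *)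

theory Defs
  imports "HOL-Complex_Analysis.Complex_Analysis" "HOL-Computational_Algebra.Polynomial"
begin

definition delta :: "nat \<Rightarrow> complex"
  where "delta n = - 1 / (2 * of_nat n + 1)"

definition coef :: "nat \<Rightarrow> complex"
  where "coef n = (1 - (delta n)\<^sup>2) / 4"

definition v1 :: "nat \<Rightarrow> complex"
  where "v1 n = - 2 / (1 + delta n)"

definition v2 :: "nat \<Rightarrow> complex"
  where "v2 n = - 2 / (1 - delta n)"

text \<open>
  On the polar set \<open>x * y = v2 n\<close> the convention of division by zero gives the value \<open>0\<close>,
  so the level sets of \<open>H n\<close> at nonzero values do not meet the polar set.
\<close>

definition H :: "nat \<Rightarrow> complex \<Rightarrow> complex \<Rightarrow> complex"
  where "H n x y = y * (1 - x * y / v1 n) ^ n / (1 - x * y / v2 n) ^ (n + 1)"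

definition ode_rhs :: "nat \<Rightarrow> complex \<Rightarrow> complex \<Rightarrow> complex"
  where "ode_rhs n x y = coef n * x * y ^ 3 + y\<^sup>2"

definition solution_curve :: "nat \<Rightarrow> complex \<Rightarrow> (complex \<times> complex) set"
  where "solution_curve n y0 = {(x, y). H n x y = y0}"


subsection \<open>Irreducible algebraic subsets of the complex affine plane\<close>

text \<open>
  A polynomial in two variables \<open>x\<close>, \<open>y\<close> is a polynomial in \<open>y\<close> whose coefficients are
  polynomials in \<open>x\<close>.
\<close>

definition algebraic_set :: "(complex \<times> complex) set \<Rightarrow> bool"
  where "algebraic_set A \<longleftrightarrow>
    (\<exists>P :: complex poly poly set. A = {(x, y). \<forall>p\<in>P. poly (poly p [:y:]) x = 0})"

definition irreducible_algebraic_set :: "(complex \<times> complex) set \<Rightarrow> bool"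
  where "irreducible_algebraic_set V \<longleftrightarrow>
    algebraic_set V \<and> V \<noteq> {} \<and>
    (\<forall>A B. algebraic_set A \<and> algebraic_set B \<and> V = A \<union> B \<longrightarrow> V = A \<or> V = B)"


subsection \<open>Branches of the solution curve\<close>

definition branch :: "nat \<Rightarrow> complex \<Rightarrow> complex set \<Rightarrow> (complex \<Rightarrow> complex) \<Rightarrow> bool"
  where "branch n y0 D g \<longleftrightarrow> g holomorphic_on D \<and> (\<forall>x\<in>D. H n x (g x) = y0)"

definition satisfies_ode :: "nat \<Rightarrow> complex set \<Rightarrow> (complex \<Rightarrow> complex) \<Rightarrow> bool"
  where "satisfies_ode n D g \<longleftrightarrow>
    (\<forall>x\<in>D. (g has_field_derivative ode_rhs n x (g x)) (at x))"

definition local_solution :: "nat \<Rightarrow> complex \<Rightarrow> (complex \<Rightarrow> complex) \<Rightarrow> bool"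
  where "local_solution n y0 f \<longleftrightarrow>
    f 0 = y0 \<and> (\<exists>r>0. satisfies_ode n (ball 0 r) f \<and> branch n y0 (ball 0 r) f)"

definition kappa :: "nat \<Rightarrow> complex"
  where "kappa n = - v2 n * (v2 n / v1 n) ^ n"

definition sing_point :: "nat \<Rightarrow> complex \<Rightarrow> complex"
  where "sing_point n y0 = kappa n / y0"

text \<open>
  The disc around \<open>0\<close> cut along the ray opposite to the direction of \<open>p\<close>: a simply connected
  domain, having \<open>0\<close> as a boundary point, over which all branches are single-valued.
\<close>

definition slit_disc :: "complex \<Rightarrow> real \<Rightarrow> complex set"
  where "slit_disc p r = ball 0 r - {of_real t * p | t. t \<le> 0}"

text \<open>
  The values \<open>f x\<close> and \<open>G i x\<close>, \<open>i < n\<close>, are the pairwise distinct points of the fibre of the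
  curve over each \<open>x\<close> in \<open>D\<close>, and the \<open>G i\<close> are the branches that tend to infinity at \<open>0\<close>.
\<close>

definition remaining_branches ::
    "nat \<Rightarrow> complex \<Rightarrow> (complex \<Rightarrow> complex) \<Rightarrow> complex set \<Rightarrow> (nat \<Rightarrow> complex \<Rightarrow> complex) \<Rightarrow> bool"
  where "remaining_branches n y0 f D G \<longleftrightarrow>
    (\<forall>i<n. branch n y0 D (G i) \<and> filterlim (G i) at_infinity (at 0 within D)) \<and>
    (\<forall>x\<in>D. inj_on (\<lambda>i. G i x) {..<n} \<and> f x \<notin> (\<lambda>i. G i x) ` {..<n} \<and>
      {y. (x, y) \<in> solution_curve n y0} = insert (f x) ((\<lambda>i. G i x) ` {..<n}))"


subsection \<open>Analytic continuation along a path\<close>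

text \<open>
  The germ of \<open>f\<close> at the initial point of \<open>\<gamma>\<close> is continued along \<open>\<gamma>\<close> by function elements
  \<open>(F t, D t)\<close>, ending with the germ of \<open>g\<close> at the final point.
\<close>

definition continues_along ::
    "(real \<Rightarrow> complex) \<Rightarrow> (complex \<Rightarrow> complex) \<Rightarrow> (complex \<Rightarrow> complex) \<Rightarrow> bool"
  where "continues_along \<gamma> f g \<longleftrightarrow> path \<gamma> \<and>
    (\<exists>F D.
      (\<forall>t\<in>{0..1}. open (D t) \<and> connected (D t) \<and> \<gamma> t \<in> D t \<and> F t holomorphic_on D t) \<and>
      (\<forall>t\<in>{0..1}. \<exists>d>0. \<forall>s\<in>{0..1}. \<bar>s - t\<bar> < d \<longrightarrow>
        \<gamma> s \<in> D t \<and> (\<forall>\<^sub>F z in nhds (\<gamma> s). F s z = F t z)) \<and>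
      (\<forall>\<^sub>F z in nhds (pathstart \<gamma>). F 0 z = f z) \<and>
      (\<forall>\<^sub>F z in nhds (pathfinish \<gamma>). F 1 z = g z))"

text \<open>The circle around \<open>a\<close> starting at \<open>b\<close>, run through \<open>k\<close> times counter-clockwise.\<close>

definition turns :: "complex \<Rightarrow> complex \<Rightarrow> nat \<Rightarrow> real \<Rightarrow> complex"
  where "turns a b k =
    part_circlepath a (dist a b) (Arg (b - a)) (Arg (b - a) + 2 * pi * real k)"

text \<open>
  The point at distance \<open>\<epsilon>\<close> from \<open>0\<close> in the direction of \<open>p\<close>.
\<close>

definition base_point :: "complex \<Rightarrow> real \<Rightarrow> complex"
  where "base_point p \<epsilon> = of_real \<epsilon> * sgn p"

text \<open>
  The loop \<open>\<omega>\<close> around \<open>p\<close> with a circle of radius \<open>\<rho>\<close>. The branch obtained by continuation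
  along it has no finite value at \<open>0\<close>, so the way back stops at distance \<open>\<epsilon>\<close> from \<open>0\<close>.
\<close>

definition omega :: "complex \<Rightarrow> real \<Rightarrow> real \<Rightarrow> real \<Rightarrow> complex"
  where "omega p \<rho> \<epsilon> =
    (let a = p - of_real \<rho> * sgn p
     in linepath 0 a +++ turns p a 1 +++ linepath a (base_point p \<epsilon>))"

end

theory Submission
  imports Defs
begin

text \<open>
  In the coordinate \<open>t = (1 - x y / v1) / (1 - x y / v2)\<close> the curve is rational:
  \<open>x = (2 n + 1) t^n (1 - t) / y0\<close> and \<open>y = y0 / (t^n ((n + 1) t - n))\<close>, where
  \<open>t\<close> runs over the plane without \<open>0\<close> and \<open>t* = n / (n + 1)\<close>. This gives irreducibility.
  Continuing \<open>y\<close> along a path in \<open>x\<close> means lifting the path to the \<open>t\<close>-plane, where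
  the regular branch at \<open>x = 0\<close> sits at \<open>t = 1\<close> and the other \<open>n\<close> branches near
  \<open>t = 0\<close>. The remaining critical point \<open>t*\<close> is a simple fold over the singular point
  \<open>x0\<close>: on the real segment \<open>t\<close> moves from \<open>1\<close> down to \<open>t*\<close>, the circle
  around \<open>x0\<close> carries it to the other side of \<open>t*\<close>, and on the way back it moves on
  towards \<open>0\<close>, where \<open>x\<close> is an \<open>n\<close>-th power of a local coordinate, so that
  turns around \<open>x = 0\<close> permute the \<open>n\<close> branches cyclically.
\<close>

subsection \<open>Analytic continuation by lifting paths\<close>

lemma holomorphic_on_imp_isCont:
  assumes "f holomorphic_on S" "open S" "x \<in> S"
  shows "isCont f x"
  using assms holomorphic_on_imp_continuous_on continuous_on_eq_continuous_at by blast

lemma holomorphic_local_inverse: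
  assumes "f holomorphic_on S" "open S" "\<xi> \<in> S" "deriv f \<xi> \<noteq> 0"
  obtains U g where "open U" "\<xi> \<in> U" "U \<subseteq> S" "connected U" "inj_on f U"
    "open (f ` U)" "connected (f ` U)" "g holomorphic_on f ` U" "\<And>z. z \<in> U \<Longrightarrow> g (f z) = z"
proof -
  obtain r where r: "r > 0" "ball \<xi> r \<subseteq> S" "open (f ` ball \<xi> r)" "inj_on f (ball \<xi> r)"
    using has_complex_derivative_locally_invertible assms by blast
  have hol: "f holomorphic_on ball \<xi> r"
    using assms r holomorphic_on_subset by blast
  obtain g where "g holomorphic_on f ` ball \<xi> r" "\<And>z. z \<in> ball \<xi> r \<Longrightarrow> g (f z) = z"
    using holomorphic_has_inverse[OF hol open_ball r(4)] by metis
  moreover have "connected (f ` ball \<xi> r)"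
    using hol by (intro connected_continuous_image holomorphic_on_imp_continuous_on) auto
  ultimately show ?thesis
    using r by (intro that[of "ball \<xi> r" g]) auto
qed

text \<open>Equality with \<open>\<gamma>\<close> is asked on the unit interval only, where a path
  is determined. In use \<open>W\<close> is \<open>param_dom n\<close>, where
  \<open>param_x n y0\<close> has nonzero derivative and \<open>param_y n y0\<close> is
  holomorphic.\<close>

definition lifts :: "(complex \<Rightarrow> complex) \<Rightarrow> complex set \<Rightarrow> (real \<Rightarrow> complex) \<Rightarrow> (real \<Rightarrow> complex) \<Rightarrow> bool"
  where "lifts f W \<gamma> \<tau> \<longleftrightarrow> path \<tau> \<and> path_image \<tau> \<subseteq> W \<and> (\<forall>s\<in>{0..1}. f (\<tau> s) = \<gamma> s)"

lemma lifts_join: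
  assumes "lifts f W \<gamma>1 \<tau>1" "lifts f W \<gamma>2 \<tau>2" "pathfinish \<tau>1 = pathstart \<tau>2"
  shows "lifts f W (\<gamma>1 +++ \<gamma>2) (\<tau>1 +++ \<tau>2)"
  using assms unfolding lifts_def by (auto simp: path_image_join) (auto simp: joinpaths_def)

text \<open>By continuity \<open>A z\<close> stays in the open set \<open>U\<close> for
  \<open>z\<close> near \<open>z0\<close>, and there \<open>g z = g (f (A z)) = A z\<close>. Thus a
  continuous local right inverse is determined near \<open>z0\<close> by where it sends
  \<open>z0\<close>.\<close>

lemma local_sections_agree:
  assumes g: "\<And>z. z \<in> U \<Longrightarrow> g (f z) = z" and "open U"
    and A: "isCont A z0" "A z0 \<in> U" "\<forall>\<^sub>F z in nhds z0. f (A z) = z"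
  shows "\<forall>\<^sub>F z in nhds z0. A z = g z"
proof -
  have "\<forall>\<^sub>F z in nhds z0. A z \<in> U"
    by (rule topological_tendstoD[OF A(1)[unfolded isCont_def tendsto_at_iff_tendsto_nhds] \<open>open U\<close> A(2)])
  then show ?thesis
    using A(3) by eventually_elim (metis g)
qed

text \<open>
  Near \<open>\<gamma> s\<close> the function element is \<open>Y \<circ> g\<close>, with \<open>g\<close> the local inverse of \<open>Q\<close>
  that maps \<open>\<gamma> s\<close> to \<open>\<tau> s\<close>.
\<close>

lemma continues_along_lift:
  assumes Q: "Q holomorphic_on W" "open W" "\<And>w. w \<in> W \<Longrightarrow> deriv Q w \<noteq> 0"
    and Y: "Y holomorphic_on W"
    and lift: "lifts Q W \<gamma> \<tau>"
    and A: "isCont A (pathstart \<gamma>)" "A (pathstart \<gamma>) = pathstart \<tau>"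
      "\<forall>\<^sub>F z in nhds (pathstart \<gamma>). Q (A z) = z \<and> f z = Y (A z)"
    and B: "isCont B (pathfinish \<gamma>)" "B (pathfinish \<gamma>) = pathfinish \<tau>"
      "\<forall>\<^sub>F z in nhds (pathfinish \<gamma>). Q (B z) = z \<and> g z = Y (B z)"
  shows "continues_along \<gamma> f g"
proof -
  have \<tau>: "continuous_on {0..1} \<tau>" and \<tau>W: "\<And>s. s \<in> {0..1} \<Longrightarrow> \<tau> s \<in> W"
    and Q\<tau>: "\<And>s. s \<in> {0..1} \<Longrightarrow> Q (\<tau> s) = \<gamma> s"
    using lift by (auto simp: lifts_def path_def path_image_def)
  have "\<exists>U P. open U \<and> w \<in> U \<and> U \<subseteq> W \<and> inj_on Q U \<and> open (Q ` U) \<and> connected (Q ` U) \<and>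
      P holomorphic_on Q ` U \<and> (\<forall>z\<in>U. P (Q z) = z)" if "w \<in> W" for w
    by (rule holomorphic_local_inverse[OF Q(1,2) that Q(3)[OF that]]) blast
  then obtain U P where UP: "\<And>w. w \<in> W \<Longrightarrow> open (U w) \<and> w \<in> U w \<and> U w \<subseteq> W \<and> inj_on Q (U w) \<and>
      open (Q ` U w) \<and> connected (Q ` U w) \<and> P w holomorphic_on Q ` U w \<and> (\<forall>z\<in>U w. P w (Q z) = z)"
    by metis
  define D where "D t = Q ` U (\<tau> t)" for t
  define F where "F t = Y \<circ> P (\<tau> t)" for t
  have sec: "\<forall>\<^sub>F z in nhds (\<gamma> s). C z = P (\<tau> t) z"
    if "t \<in> {0..1}" "isCont C (\<gamma> s)" "C (\<gamma> s) \<in> U (\<tau> t)" "\<forall>\<^sub>F z in nhds (\<gamma> s). Q (C z) = z" for C s t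
    by (rule local_sections_agree[where U = "U (\<tau> t)"]) (use that UP[OF \<tau>W] in auto)
  have P: "isCont (P (\<tau> s)) (\<gamma> s)" "P (\<tau> s) (\<gamma> s) = \<tau> s" "\<forall>\<^sub>F z in nhds (\<gamma> s). Q (P (\<tau> s) z) = z"
    if s: "s \<in> {0..1}" for s
  proof -
    have u: "open (D s)" "\<gamma> s \<in> D s" "P (\<tau> s) holomorphic_on D s"
      using UP[OF \<tau>W[OF s]] Q\<tau>[OF s] unfolding D_def by (auto intro!: image_eqI[of _ _ "\<tau> s"])
    then show "isCont (P (\<tau> s)) (\<gamma> s)"
      using continuous_on_eq_continuous_at holomorphic_on_imp_continuous_on by blast
    show "P (\<tau> s) (\<gamma> s) = \<tau> s"
      using UP[OF \<tau>W[OF s]] Q\<tau>[OF s] by metis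
    have "\<forall>z\<in>D s. Q (P (\<tau> s) z) = z"
      using UP[OF \<tau>W[OF s]] unfolding D_def by auto
    then show "\<forall>\<^sub>F z in nhds (\<gamma> s). Q (P (\<tau> s) z) = z"
      using u by (auto simp: eventually_nhds)
  qed
  have "path \<gamma>"
  proof -
    have "continuous_on {0..1} (Q \<circ> \<tau>)"
      using \<tau> \<tau>W holomorphic_on_imp_continuous_on[OF Q(1)]
      by (intro continuous_on_compose) (auto intro: continuous_on_subset)
    then show ?thesis
      unfolding path_def by (rule continuous_on_eq) (simp add: Q\<tau>)
  qed
  moreover have "open (D t) \<and> connected (D t) \<and> \<gamma> t \<in> D t \<and> F t holomorphic_on D t"
    if t: "t \<in> {0..1}" for t
  proof -
    have "P (\<tau> t) ` D t \<subseteq> W"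
      using UP[OF \<tau>W[OF t]] unfolding D_def by force
    then show ?thesis
      using UP[OF \<tau>W[OF t]] Q\<tau>[OF t] holomorphic_on_subset[OF Y] unfolding D_def F_def
      by (auto intro!: image_eqI[of _ _ "\<tau> t"] holomorphic_on_compose)
  qed
  moreover have "\<exists>d>0. \<forall>s\<in>{0..1}. \<bar>s - t\<bar> < d \<longrightarrow>
      \<gamma> s \<in> D t \<and> (\<forall>\<^sub>F z in nhds (\<gamma> s). F s z = F t z)" if t: "t \<in> {0..1}" for t
  proof -
    obtain e where e: "e > 0" "ball (\<tau> t) e \<subseteq> U (\<tau> t)"
      using UP[OF \<tau>W[OF t]] openE by blast
    then obtain d where d: "d > 0" "\<And>s. s \<in> {0..1} \<Longrightarrow> dist s t < d \<Longrightarrow> dist (\<tau> s) (\<tau> t) < e"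
      using \<tau> t unfolding continuous_on_iff by metis
    \<comment> \<open>While \<open>\<tau> s\<close> stays in \<open>U (\<tau> t)\<close>, the
      inverses \<open>P (\<tau> s)\<close> and \<open>P (\<tau> t)\<close> both send
      \<open>\<gamma> s\<close> to \<open>\<tau> s\<close>, so they agree near
      \<open>\<gamma> s\<close>.\<close>
    have "\<gamma> s \<in> D t \<and> (\<forall>\<^sub>F z in nhds (\<gamma> s). F s z = F t z)"
      if s: "s \<in> {0..1}" "\<bar>s - t\<bar> < d" for s
    proof -
      have \<tau>s: "\<tau> s \<in> U (\<tau> t)"
        using d(2)[OF s(1)] s e by (auto simp: dist_real_def dist_commute)
      then have "\<forall>\<^sub>F z in nhds (\<gamma> s). P (\<tau> s) z = P (\<tau> t) z"
        using P[OF s(1)] by (intro sec[OF t]) auto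
      then have "\<forall>\<^sub>F z in nhds (\<gamma> s). F s z = F t z"
        by eventually_elim (simp add: F_def)
      then show ?thesis
        using \<tau>s Q\<tau>[OF s(1)] unfolding D_def by (metis imageI)
    qed
    with \<open>d > 0\<close> show ?thesis by blast
  qed
  moreover have "\<forall>\<^sub>F z in nhds (pathstart \<gamma>). F 0 z = f z"
  proof -
    have "\<forall>\<^sub>F z in nhds (\<gamma> 0). A z = P (\<tau> 0) z"
      using A UP[OF \<tau>W, of 0] by (intro sec) (auto simp: pathstart_def elim: eventually_mono)
    with A(3) show ?thesis
      unfolding pathstart_def by eventually_elim (simp add: F_def)
  qed
  moreover have "\<forall>\<^sub>F z in nhds (pathfinish \<gamma>). F 1 z = g z"
  proof -
    have "\<forall>\<^sub>F z in nhds (\<gamma> 1). B z = P (\<tau> 1) z"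
      using B UP[OF \<tau>W, of 1] by (intro sec) (auto simp: pathfinish_def elim: eventually_mono)
    with B(3) show ?thesis
      unfolding pathfinish_def by eventually_elim (simp add: F_def)
  qed
  ultimately show ?thesis
    unfolding continues_along_def by blast
qed

text \<open>A local coordinate \<open>h\<close> at \<open>\<xi>\<close>, with inverse
  \<open>g\<close>, in which \<open>Q\<close> is a pure power up to the constant \<open>c\<close>.
  The image of \<open>h\<close> is a full disc, so that coordinates can be rotated about
  \<open>0\<close> without leaving the chart.\<close>

definition power_chart where
  "power_chart Q c k \<xi> U h g \<delta> \<longleftrightarrow> \<delta> > 0 \<and> open U \<and> \<xi> \<in> U \<and> h ` U = ball 0 \<delta> \<and> h \<xi> = 0 \<and>
    g holomorphic_on ball 0 \<delta> \<and> (\<forall>z\<in>U. g (h z) = z) \<and> (\<forall>z\<in>U. Q z = c + h z ^ k)"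
  for Q :: "complex \<Rightarrow> complex"

lemma power_chart_inverse:
  assumes "power_chart Q c k \<xi> U h g \<delta>" "z \<in> ball 0 \<delta>"
  shows "g z \<in> U" "h (g z) = z" "Q (g z) = c + z ^ k"
proof -
  obtain w where "w \<in> U" "z = h w"
    using assms unfolding power_chart_def by (metis imageE)
  then show "g z \<in> U" "h (g z) = z" "Q (g z) = c + z ^ k"
    using assms(1) by (auto simp: power_chart_def)
qed

text \<open>Near \<open>\<xi>\<close> the nonvanishing factor \<open>G\<close> has a holomorphic
  \<open>k\<close>-th root \<open>R\<close>. The coordinate \<open>(z - \<xi>) * R z\<close> has a
  simple zero at \<open>\<xi>\<close>, hence a local inverse.\<close>

lemma power_chart_exists:
  assumes G: "G holomorphic_on S" "open S" "\<xi> \<in> S" "G \<xi> \<noteq> 0"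
    and Q: "\<And>z. z \<in> S \<Longrightarrow> Q z = c + (z - \<xi>) ^ k * G z" and "k > 0"
  obtains U h g \<delta> where "U \<subseteq> S" "power_chart Q c k \<xi> U h g \<delta>"
proof -
  define C where "C = exp (Ln (G \<xi>) / of_nat k)"
  have Ck: "C ^ k = G \<xi>" and "C \<noteq> 0"
    using assms by (auto simp: C_def exp_divide_power_eq)
  have cont: "continuous_on S (\<lambda>z. G z / G \<xi>)"
    using G by (intro holomorphic_on_imp_continuous_on holomorphic_intros) auto
  \<comment> \<open>On \<open>S'\<close> the quotient \<open>G z / G \<xi>\<close> is within
    distance 1 of 1, hence in the right half plane, where \<open>Ln\<close> is holomorphic. The
    constant \<open>C\<close> restores the root of \<open>G \<xi>\<close>.\<close>
  define S' where "S' = S \<inter> (\<lambda>z. G z / G \<xi>) -` ball 1 1"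
  have S': "open S'" "\<xi> \<in> S'" "S' \<subseteq> S"
    using continuous_open_preimage[OF cont \<open>open S\<close> open_ball, of 1 1] G by (auto simp: S'_def)
  have Re: "Re (G z / G \<xi>) > 0" if "z \<in> S'" for z
  proof -
    have "cmod (1 - G z / G \<xi>) < 1" using that by (auto simp: S'_def dist_norm)
    with complex_Re_le_cmod[of "1 - G z / G \<xi>"] show ?thesis by simp
  qed
  then have slit: "G z / G \<xi> \<notin> \<real>\<^sub>\<le>\<^sub>0" if "z \<in> S'" for z
    using that by (force simp: complex_nonpos_Reals_iff)
  define R where "R z = C * exp (Ln (G z / G \<xi>) / of_nat k)" for z
  define h where "h z = (z - \<xi>) * R z" for z
  have R: "R holomorphic_on S'"
    unfolding R_def using G slit S' holomorphic_on_subset[OF G(1) S'(3)]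
    by (auto intro!: holomorphic_intros)
  then have h: "h holomorphic_on S'"
    unfolding h_def by (auto intro!: holomorphic_intros)
  have Rk: "R z ^ k = G z" if "z \<in> S'" for z
  proof -
    have "G z / G \<xi> \<noteq> 0" using Re[OF that] by auto
    then have "exp (Ln (G z / G \<xi>)) = G z / G \<xi>" by (rule exp_Ln)
    then show ?thesis
      using G \<open>k > 0\<close> by (simp add: R_def power_mult_distrib Ck exp_divide_power_eq)
  qed
  have "(R has_field_derivative deriv R \<xi>) (at \<xi>)"
    using R S' holomorphic_derivI by blast
  then have "(h has_field_derivative R \<xi>) (at \<xi>)"
    unfolding h_def by (auto intro!: derivative_eq_intros)
  then have "deriv h \<xi> \<noteq> 0"
    using \<open>C \<noteq> 0\<close> by (auto simp: DERIV_imp_deriv R_def)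
  then obtain V g where V: "open V" "\<xi> \<in> V" "V \<subseteq> S'" "open (h ` V)" "g holomorphic_on h ` V"
      "\<And>z. z \<in> V \<Longrightarrow> g (h z) = z"
    using holomorphic_local_inverse[OF h S'(1,2)] by metis
  have "0 \<in> h ` V" using V(2) by (force simp: h_def)
  then obtain \<delta> where \<delta>: "\<delta> > 0" "ball 0 \<delta> \<subseteq> h ` V" using V(4) openE by blast
  \<comment> \<open>Shrinking \<open>V\<close> to the preimage of a disc makes the image of the
    chart a full disc.\<close>
  define U where "U = V \<inter> h -` ball 0 \<delta>"
  have "open U"
    unfolding U_def using V h
    by (intro continuous_open_preimage) (auto intro: continuous_on_subset holomorphic_on_imp_continuous_on)
  moreover have "h ` U = ball 0 \<delta>" using \<delta> unfolding U_def by blast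
  moreover have "Q z = c + h z ^ k" if "z \<in> U" for z
  proof -
    have "z \<in> S'" "z \<in> S" using that V S' by (auto simp: U_def)
    then show ?thesis using Rk Q by (simp add: h_def power_mult_distrib)
  qed
  moreover have "g holomorphic_on ball 0 \<delta>" using V(5) \<delta>(2) holomorphic_on_subset by blast
  moreover have "\<xi> \<in> U" using V \<delta> by (auto simp: U_def h_def)
  moreover have "U \<subseteq> S" using V S' by (auto simp: U_def)
  moreover have "h \<xi> = 0" by (simp add: h_def)
  ultimately show ?thesis
    using \<delta> V(6) by (intro that[of U h g \<delta>]) (auto simp: U_def power_chart_def)
qed

text \<open>The radius and the starting angle recombine to \<open>b - a\<close> by the polar form.
  This also holds for \<open>b = a\<close>, where the radius is 0.\<close>

lemma turns_eq: "turns a b k s = a + (b - a) * exp (2 * of_real pi * \<i> * of_nat k * of_real s)"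
proof -
  have "turns a b k s = a + (of_real (cmod (b - a)) * exp (\<i> * of_real (Arg (b - a)))) *
      exp (2 * of_real pi * \<i> * of_nat k * of_real s)"
    by (simp add: turns_def part_circlepath_def linepath_def dist_norm norm_minus_commute
        mult.assoc flip: exp_add) (simp add: algebra_simps scaleR_conv_of_real)
  also have "of_real (cmod (b - a)) * exp (\<i> * of_real (Arg (b - a))) = b - a"
    by (metis Arg_eq Arg_zero cis_conv_exp exp_zero mult_zero_left norm_zero of_real_0)
  finally show ?thesis .
qed

text \<open>
  The coordinate \<open>h\<close> turns \<open>Q\<close> into the power map, so that a turn of \<open>2 \<pi> j\<close> around \<open>c\<close>
  lifts to a turn of \<open>2 \<pi> j / k\<close> around \<open>\<xi>\<close>.
\<close>

lemma lifts_turns: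
  assumes chart: "power_chart Q c k \<xi> U h g \<delta>" and "k > 0" and W: "U - {\<xi>} \<subseteq> W"
    and t: "t \<in> U" "t \<noteq> \<xi>" and b: "Q t = b"
  shows "lifts Q W (turns c b j) (\<lambda>s. g (h t * exp (2 * of_real pi * \<i> * of_nat j * of_real s / of_nat k)))"
proof -
  have h: "h ` U = ball 0 \<delta>" "g holomorphic_on ball 0 \<delta>" "\<And>z. z \<in> U \<Longrightarrow> g (h z) = z"
    "h \<xi> = 0" "\<xi> \<in> U" "Q t = c + h t ^ k"
    using chart t(1) by (auto simp: power_chart_def)
  define e where "e s = h t * exp (2 * of_real pi * \<i> * of_nat j * of_real s / of_nat k)" for s :: real
  have "cmod (e s) = cmod (h t)" for s
    by (simp add: e_def norm_mult)
  then have eB: "e s \<in> ball 0 \<delta>" for s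
    using h(1) t(1) by auto
  note ge = power_chart_inverse[OF chart eB]
  have ht: "h t \<noteq> 0" using h t by metis
  have "continuous_on {0..1} (g \<circ> e)"
    using eB \<open>k > 0\<close>
    by (intro continuous_on_compose continuous_on_subset[OF holomorphic_on_imp_continuous_on[OF h(2)]])
      (auto simp: e_def intro!: continuous_intros)
  moreover have "g (e s) \<in> W" for s
  proof -
    have "e s \<noteq> 0" using ht by (simp add: e_def)
    then show ?thesis using ge(1,2)[of s] h(4) W by (metis Diff_iff singletonD subsetD)
  qed
  moreover have "Q (g (e s)) = turns c b j s" for s
  proof -
    have "e s ^ k = h t ^ k * exp (2 * of_real pi * \<i> * of_nat j * of_real s)"
      using \<open>k > 0\<close> by (simp add: e_def power_mult_distrib exp_divide_power_eq)
    also have "h t ^ k = b - c" using h(6) b by simp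
    finally show ?thesis by (simp add: turns_eq ge(3))
  qed
  ultimately show ?thesis
    by (auto simp: lifts_def path_def path_image_def e_def comp_def)
qed

subsection \<open>Rational parametrization of the solution curve\<close>

definition crit :: "nat \<Rightarrow> complex"
  where "crit n = of_nat n / (of_nat n + 1)"

definition param_dom :: "nat \<Rightarrow> complex set"
  where "param_dom n = - {0, crit n}"

definition param_x :: "nat \<Rightarrow> complex \<Rightarrow> complex \<Rightarrow> complex"
  where "param_x n y0 t = (2 * of_nat n + 1) * t ^ n * (1 - t) / y0"

definition param_y :: "nat \<Rightarrow> complex \<Rightarrow> complex \<Rightarrow> complex"
  where "param_y n y0 t = y0 / (t ^ n * ((of_nat n + 1) * t - of_nat n))"

definition param :: "nat \<Rightarrow> complex \<Rightarrow> complex \<Rightarrow> complex"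
  where "param n x y = (1 - x * y / v1 n) / (1 - x * y / v2 n)"

section \<open>Closed forms of the constants\<close>

lemma of_nat_add_1_neq_0 [simp]: "of_nat n + 1 \<noteq> (0 :: complex)" "1 + of_nat n \<noteq> (0 :: complex)"
  by (metis of_nat_1 of_nat_add of_nat_eq_0_iff add_is_0 one_neq_zero)+

lemma two_of_nat_add_1_neq_0 [simp]: "2 * of_nat n + 1 \<noteq> (0 :: complex)" "1 + 2 * of_nat n \<noteq> (0 :: complex)"
proof -
  have "2 * of_nat n + 1 = (of_nat (2 * n + 1) :: complex)" by simp
  then show "2 * of_nat n + 1 \<noteq> (0 :: complex)" by (metis of_nat_eq_0_iff add_is_0 one_neq_zero)
  then show "1 + 2 * of_nat n \<noteq> (0 :: complex)" by (simp add: add.commute)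
qed

text \<open>At \<open>n = 0\<close> both sides are 0 through division by zero, since
  \<open>1 + delta 0 = 0\<close>.\<close>

lemma v1_eq: "v1 n = - ((2 * of_nat n + 1) / of_nat n)"
proof -
  have "1 + delta n = 2 * of_nat n / (2 * of_nat n + 1)"
    by (simp add: delta_def diff_divide_eq_iff)
  moreover have "- 2 / (2 * M / N) = - (N / M)" for M N :: complex
    by simp
  ultimately show ?thesis by (simp only: v1_def)
qed

lemma v2_eq: "v2 n = - ((2 * of_nat n + 1) / (of_nat n + 1))"
proof -
  have "1 - delta n = 2 * (of_nat n + 1) / (2 * of_nat n + 1)"
    by (simp add: delta_def add_divide_eq_iff)
  moreover have "- 2 / (2 * M / N) = - (N / M)" for M N :: complex
    by simp
  ultimately show ?thesis by (simp only: v2_def)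
qed

lemma coef_eq: "coef n = of_nat n * (of_nat n + 1) / (2 * of_nat n + 1)\<^sup>2"
proof -
  define N where "N = (2 * of_nat n + 1 :: complex)"
  have N: "N \<noteq> 0" "of_nat n = (N - 1) / 2" by (simp_all add: N_def)
  have "coef n = (1 - 1 / N\<^sup>2) / 4"
    by (simp add: coef_def delta_def N_def power_divide)
  also have "\<dots> = of_nat n * (of_nat n + 1) / N\<^sup>2"
    using N(1) unfolding N(2) by (simp add: field_simps power2_eq_square)
  finally show ?thesis by (simp add: N_def)
qed

lemma kappa_eq: "n \<ge> 1 \<Longrightarrow> kappa n = (2 * of_nat n + 1) * of_nat n ^ n / (of_nat n + 1) ^ (n + 1)"
  by (simp add: kappa_def v1_eq v2_eq power_divide)

lemma open_param_dom: "open (param_dom n)"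
  by (simp add: param_dom_def open_Compl)

lemma crit_iff: "(of_nat n + 1) * t = of_nat n \<longleftrightarrow> t = crit n"
  by (simp add: crit_def field_simps)

lemma param_dom_iff: "t \<in> param_dom n \<longleftrightarrow> t \<noteq> 0 \<and> (of_nat n + 1) * t - of_nat n \<noteq> 0"
  by (simp add: param_dom_def crit_iff)

text \<open>The constant \<open>kappa n\<close> is the value of \<open>(2 n + 1) t^n (1 - t)\<close>
  at \<open>crit n\<close>. This identifies the singular point with the critical value at the
  fold.\<close>

lemma param_x_crit: "n \<ge> 1 \<Longrightarrow> param_x n y0 (crit n) = sing_point n y0"
  by (simp add: param_x_def crit_def sing_point_def kappa_eq divide_simps)

lemma sing_point_neq_0: "n \<ge> 1 \<Longrightarrow> y0 \<noteq> 0 \<Longrightarrow> sing_point n y0 \<noteq> 0"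
  by (simp add: sing_point_def kappa_eq)

text \<open>Put \<open>d = (n + 1) t - n\<close>. The two linear factors in \<open>H\<close> become
  \<open>t / d\<close> and \<open>1 / d\<close>: their quotient is \<open>t\<close>, and
  \<open>H\<close> becomes \<open>y t^n d\<close>, which is \<open>y0\<close>.\<close>

lemma
  assumes "n \<ge> 1" "y0 \<noteq> 0" "t \<in> param_dom n"
  defines "x \<equiv> param_x n y0 t" and "y \<equiv> param_y n y0 t"
  shows param_param: "param n x y = t"
    and H_param: "H n x y = y0"
proof -
  define d where "d = (of_nat n + 1) * t - of_nat n"
  have d: "d \<noteq> 0" "t \<noteq> 0" using assms(3) by (auto simp: param_dom_iff d_def)
  have xy: "x * y = (2 * of_nat n + 1) * (1 - t) / d"
    using assms(2) d by (simp add: x_def y_def param_x_def param_y_def flip: d_def)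
  have 1: "1 - x * y / v1 n = t / ((of_nat n + 1) * t - of_nat n)"
    using assms(1) d unfolding xy d_def[symmetric]
    by (simp add: v1_eq add_divide_eq_iff eq_divide_eq) (simp add: d_def algebra_simps)
  have 2: "1 - x * y / v2 n = 1 / ((of_nat n + 1) * t - of_nat n)"
    using assms(1) d unfolding xy d_def[symmetric]
    by (simp add: v2_eq add_divide_eq_iff eq_divide_eq) (simp add: d_def algebra_simps)
  show "param n x y = t"
    using d unfolding param_def 1 2 by (simp flip: d_def)
  show "H n x y = y0"
    using d unfolding H_def 1 2 by (simp add: y_def param_y_def power_divide flip: d_def)
qed

text \<open>The linear factors \<open>a\<close> and \<open>b\<close> satisfy
  \<open>(n + 1) a - n b = 1\<close> and \<open>b - a = x y / (2 n + 1)\<close>. Dividing by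
  \<open>b\<close> expresses \<open>(n + 1) t - n\<close> and \<open>1 - t\<close> through
  \<open>x y\<close> and \<open>b\<close>, and the equation of the curve reads
  \<open>y0 = y t^n / b\<close>.\<close>

lemma
  assumes "n \<ge> 1" "y0 \<noteq> 0" "H n x y = y0"
  shows H_denom: "1 - x * y / v2 n \<noteq> 0"
    and param_in_dom: "param n x y \<in> param_dom n"
    and param_x_param: "param_x n y0 (param n x y) = x"
    and param_y_param: "param_y n y0 (param n x y) = y"
proof -
  define N where "N = (2 * of_nat n + 1 :: complex)"
  define a where "a = 1 - x * y / v1 n"
  define b where "b = 1 - x * y / v2 n"
  define t where "t = param n x y"
  have H: "y * a ^ n / b ^ (n + 1) = y0" using assms(3) by (simp add: H_def a_def b_def)
  \<comment> \<open>If \<open>a\<close>, \<open>b\<close> or \<open>y\<close> were 0, the left side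
    of the equation would be 0, in the case of \<open>b\<close> by the convention on
    division.\<close>
  then have nz: "a \<noteq> 0" "b \<noteq> 0" "y \<noteq> 0"
    using assms(1,2) by (auto simp: power_0_left)
  then show "1 - x * y / v2 n \<noteq> 0" by (simp add: b_def)
  have t: "t = a / b" by (simp add: t_def param_def a_def b_def)
  have ab: "a = 1 + of_nat n * (x * y) / N" "b = 1 + (of_nat n + 1) * (x * y) / N"
    using assms(1) by (simp_all add: a_def b_def v1_eq v2_eq N_def mult.commute)
  have N: "N \<noteq> 0" by (simp add: N_def)
  have 1: "(of_nat n + 1) * a - of_nat n * b = 1"
    using N unfolding ab by (simp add: field_simps)
  have 2: "b - a = x * y / N"
    using N unfolding ab by (simp add: field_simps)
  have d: "(of_nat n + 1) * t - of_nat n = 1 / b"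
    using nz 1 by (simp add: t divide_simps)
  have t1: "1 - t = x * y / (N * b)"
    using nz 2 N by (simp add: t divide_simps)
  have y0: "y0 = y * t ^ n / b"
    using H nz by (simp add: t power_divide mult.commute)
  show "param n x y \<in> param_dom n"
    using d nz by (auto simp: param_dom_iff t simp flip: t_def)
  show "param_y n y0 (param n x y) = y"
    unfolding param_y_def t_def[symmetric] d using nz by (simp add: y0 t)
  show "param_x n y0 (param n x y) = x"
    unfolding param_x_def t_def[symmetric] t1 N_def[symmetric] using nz N by (simp add: y0 t)
qed

lemma solution_curve_eq:
  assumes "n \<ge> 1" "y0 \<noteq> 0"
  shows "solution_curve n y0 = (\<lambda>t. (param_x n y0 t, param_y n y0 t)) ` param_dom n"
  using H_param[OF assms] param_in_dom[OF assms] param_x_param[OF assms] param_y_param[OF assms]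
  by (force simp: solution_curve_def image_iff)

section \<open>Derivative of the parametrization and the differential equation\<close>

lemma param_x_deriv:
  assumes "n \<ge> 1"
  shows "(param_x n y0 has_field_derivative
    (2 * of_nat n + 1) * t ^ (n - 1) * (of_nat n - (of_nat n + 1) * t) / y0) (at t)"
proof -
  obtain m where m: "n = Suc m" using assms by (cases n) auto
  have "((\<lambda>t. (2 * of_nat n + 1) * t ^ n * (1 - t)) has_field_derivative
      (2 * of_nat n + 1) * t ^ (n - 1) * (of_nat n - (of_nat n + 1) * t)) (at t)"
    by (rule derivative_eq_intros refl)+ (simp add: m algebra_simps)
  then show ?thesis
    unfolding param_x_def by (rule DERIV_cdivide)
qed

lemma param_x_holomorphic: "param_x n y0 holomorphic_on S"
  unfolding param_x_def by (cases "y0 = 0") (auto intro!: holomorphic_intros)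

lemma deriv_param_x:
  assumes "n \<ge> 1"
  shows "deriv (param_x n y0) t = (2 * of_nat n + 1) * t ^ (n - 1) * (of_nat n - (of_nat n + 1) * t) / y0"
  using param_x_deriv[OF assms] by (rule DERIV_imp_deriv)

lemma deriv_param_x_neq_0:
  assumes "n \<ge> 1" "y0 \<noteq> 0" "t \<in> param_dom n"
  shows "deriv (param_x n y0) t \<noteq> 0"
  using assms by (auto simp: deriv_param_x param_dom_iff)

lemma param_y_holomorphic: "param_y n y0 holomorphic_on param_dom n"
  unfolding param_y_def by (intro holomorphic_intros) (auto simp: param_dom_iff)

text \<open>The denominator of \<open>param\<close> has no zero on the curve.\<close>

lemma param_branch_holomorphic:
  assumes "n \<ge> 1" "y0 \<noteq> 0" "branch n y0 S g"
  shows "(\<lambda>x. param n x (g x)) holomorphic_on S"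
  unfolding param_def using assms H_denom[OF assms(1,2)]
  by (auto intro!: holomorphic_intros simp: branch_def v1_eq v2_eq)

text \<open>
  With \<open>t\<close> the parameter of the point \<open>(x, g x)\<close>, differentiating \<open>param_x n y0 (t x) = x\<close>
  gives \<open>t' = - g t / (2 n + 1)\<close>, and \<open>g = param_y n y0 (t x)\<close>.
\<close>

lemma branch_satisfies_ode:
  assumes "n \<ge> 1" "y0 \<noteq> 0" "open S" "branch n y0 S g"
  shows "satisfies_ode n S g"
  unfolding satisfies_ode_def
proof
  fix x assume x: "x \<in> S"
  have H: "\<And>x. x \<in> S \<Longrightarrow> H n x (g x) = y0"
    using assms by (auto simp: branch_def)
  define T where "T x = param n x (g x)" for x
  have "T holomorphic_on S"
    unfolding T_def by (rule param_branch_holomorphic[OF assms(1,2,4)])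
  then obtain T' where T': "(T has_field_derivative T') (at x)"
    using x \<open>open S\<close> holomorphic_derivI by blast
  define t where "t = T x"
  define d where "d = (of_nat n + 1) * t - of_nat n"
  have t: "t \<in> param_dom n" "param_x n y0 t = x" "param_y n y0 t = g x"
    using H[OF x] by (simp_all add: t_def T_def param_in_dom[OF assms(1,2)]
        param_x_param[OF assms(1,2)] param_y_param[OF assms(1,2)])
  then have nz: "t \<noteq> 0" "d \<noteq> 0" by (auto simp: param_dom_iff d_def)
  obtain m where m: "n = Suc m" using assms(1) by (cases n) auto
  define N where "N = (2 * of_nat n + 1 :: complex)"
  have N: "N \<noteq> 0" unfolding N_def by simp
  have "((\<lambda>x. param_x n y0 (T x)) has_field_derivative - N * t ^ m * d / y0 * T') (at x)"
    by (rule DERIV_chain2[OF _ T'])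
      (use param_x_deriv[OF assms(1), of y0 t] in \<open>simp add: t_def d_def N_def m algebra_simps\<close>)
  moreover have "((\<lambda>x. param_x n y0 (T x)) has_field_derivative 1) (at x)"
    by (rule has_field_derivative_transform_within_open[OF DERIV_ident \<open>open S\<close> x])
      (simp add: T_def param_x_param[OF assms(1,2)] H)
  ultimately have "- N * t ^ m * d / y0 * T' = 1"
    by (rule DERIV_unique)
  then have "y0 = - (N * t ^ m * d * T')"
    using assms(2) by (simp add: divide_simps)
  then have "T' = - (y0 / (t ^ n * d)) * t / N"
    using nz N by (simp add: m)
  then have T'_eq: "T' = - g x * t / N"
    by (simp add: param_y_def d_def flip: t(3))
  have gx: "g x = y0 / (t ^ n * d)" using t(3) by (simp add: param_y_def d_def)
  have "((\<lambda>x. param_y n y0 (T x)) has_field_derivative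
      - (g x * (of_nat n / t + (of_nat n + 1) / d)) * T') (at x)"
  proof (rule DERIV_chain2[OF _ T'])
    show "(param_y n y0 has_field_derivative - (g x * (of_nat n / t + (of_nat n + 1) / d))) (at (T x))"
      unfolding param_y_def t_def[symmetric] gx
      by (rule derivative_eq_intros refl | simp add: nz d_def[symmetric])+
        (simp add: m d_def[symmetric] nz divide_simps, simp add: algebra_simps)
  qed
  then have "(g has_field_derivative - (g x * (of_nat n / t + (of_nat n + 1) / d)) * T') (at x)"
    by (rule has_field_derivative_transform_within_open[OF _ \<open>open S\<close> x])
      (simp add: T_def param_y_param[OF assms(1,2)] H)
  moreover have "- (g x * (of_nat n / t + (of_nat n + 1) / d)) * T' = ode_rhs n x (g x)"
  proof -
    have xg: "x * g x = N * (1 - t) / d"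
    proof -
      have "x * g x = param_x n y0 t * (y0 / (t ^ n * d))" by (simp only: t(2) gx)
      then show ?thesis using nz assms(2) by (simp add: param_x_def N_def)
    qed
    \<comment> \<open>Up to the factor \<open>(g x)\<^sup>2\<close> the right side depends only on
      \<open>x * g x\<close>, which is rational in \<open>t\<close>. The identity
      \<open>N d + n (n + 1) (1 - t) = n d + (n + 1) t\<close> then brings it to the derivative
      found above.\<close>
    have "ode_rhs n x (g x) = (g x)\<^sup>2 * (1 + coef n * (x * g x))"
      by (simp add: ode_rhs_def algebra_simps power2_eq_square power3_eq_cube)
    also have "\<dots> = (g x)\<^sup>2 * (1 + of_nat n * (of_nat n + 1) * (1 - t) / (N * d))"
      using N nz unfolding xg coef_eq by (simp add: power2_eq_square flip: N_def)
    also have "1 + of_nat n * (of_nat n + 1) * (1 - t) / (N * d) =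
        (of_nat n * d + (of_nat n + 1) * t) / (N * d)"
      using N nz by (simp add: divide_simps) (simp add: d_def N_def algebra_simps)
    also have "(g x)\<^sup>2 * \<dots> = - (g x * (of_nat n / t + (of_nat n + 1) / d)) * T'"
      using N nz by (simp add: T'_eq power2_eq_square divide_simps)
    finally show ?thesis by simp
  qed
  ultimately show "(g has_field_derivative ode_rhs n x (g x)) (at x)" by simp
qed

subsection \<open>Irreducibility and the local solution\<close>

text \<open>Clearing the denominator adds no points. Where \<open>x y = v2 n\<close>, the polynomial
  reduces to \<open>y (1 - x y / v1)^n\<close>, which is nonzero as \<open>v1 n\<close> and
  \<open>v2 n\<close> differ, while \<open>H\<close> is \<open>0\<close> there and so is not
  \<open>y0\<close>.\<close>

lemma algebraic_solution_curve:
  assumes "n \<ge> 1" "y0 \<noteq> 0"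
  shows "algebraic_set (solution_curve n y0)"
proof -
  \<comment> \<open>The polynomial \<open>[:[:0, 1:]:]\<close> stands for \<open>x\<close> and
    \<open>[:0, 1:]\<close> for \<open>y\<close>, the outer variable.\<close>
  define L :: "complex \<Rightarrow> complex poly poly" where "L v = 1 - [:[:1 / v:]:] * [:[:0, 1:]:] * [:0, 1:]" for v
  define p where "p = [:0, 1:] * L (v1 n) ^ n - [:[:y0:]:] * L (v2 n) ^ (n + 1)"
  have L: "poly (poly (L v) [:y:]) x = 1 - x * y / v" for v x y
    by (simp add: L_def)
  have ev: "poly (poly p [:y:]) x = y * (1 - x * y / v1 n) ^ n - y0 * (1 - x * y / v2 n) ^ (n + 1)" for x y
    by (simp add: p_def poly_power L)
  have "H n x y = y0 \<longleftrightarrow> poly (poly p [:y:]) x = 0" for x y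
  proof (cases "1 - x * y / v2 n = 0")
    case True
    have "1 - x * y / v1 n \<noteq> 0"
    proof
      assume "1 - x * y / v1 n = 0"
      with True have "x * y / v1 n = 1" "x * y / v2 n = 1" by simp_all
      then have "v1 n = v2 n" by (metis div_by_0 nonzero_divide_eq_eq one_neq_zero mult_1)
      then have "of_nat n + 1 = (of_nat n :: complex)"
        using assms(1) unfolding v1_eq v2_eq by (simp add: frac_eq_eq mult_cancel_left del: add_cancel_left_right)
      then show False by simp
    qed
    moreover from True have "y \<noteq> 0" by auto
    ultimately show ?thesis
      using assms unfolding ev H_def True by (simp add: power_0_left)
  next
    case False
    then show ?thesis by (auto simp add: ev H_def divide_eq_eq)
  qed
  then have "solution_curve n y0 = {(x, y). \<forall>p\<in>{p}. poly (poly p [:y:]) x = 0}"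
    by (auto simp: solution_curve_def)
  then show ?thesis unfolding algebraic_set_def by blast
qed

lemma holomorphic_on_poly_poly:
  fixes p :: "complex poly poly"
  assumes "X holomorphic_on S" "Y holomorphic_on S"
  shows "(\<lambda>t. poly (poly p [:Y t:]) (X t)) holomorphic_on S"
proof -
  have c: "(\<lambda>t. poly c (X t)) holomorphic_on S" for c
    by (induction c) (auto intro!: holomorphic_intros assms)
  show ?thesis
    by (induction p) (auto intro!: holomorphic_intros assms c)
qed

lemma connected_param_dom: "connected (param_dom n)"
proof -
  have "connected (UNIV - {0, crit n})"
    by (rule connected_open_delete_finite) auto
  then show ?thesis by (simp add: param_dom_def Compl_eq_Diff_UNIV)
qed

text \<open>
  Pulled back along the parametrization, the polynomials defining a closed subset are
  holomorphic on a connected domain, so that they vanish as soon as their zeros accumulate.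
\<close>

lemma irreducible_solution_curve:
  assumes "n \<ge> 1" "y0 \<noteq> 0"
  shows "irreducible_algebraic_set (solution_curve n y0)"
proof -
  define \<Phi> where "\<Phi> t = (param_x n y0 t, param_y n y0 t)" for t
  have V: "solution_curve n y0 = \<Phi> ` param_dom n"
    using solution_curve_eq[OF assms] by (simp add: \<Phi>_def)
  have one: "1 \<in> param_dom n" by (simp add: param_dom_iff)
  have full: "solution_curve n y0 \<subseteq> A"
    if A: "algebraic_set A" and lim: "1 islimpt (param_dom n \<inter> \<Phi> -` A)" for A
  proof -
    obtain P :: "complex poly poly set" where P: "A = {(x, y). \<forall>p\<in>P. poly (poly p [:y:]) x = 0}"
      using A unfolding algebraic_set_def by blast
    have "poly (poly p [:param_y n y0 t:]) (param_x n y0 t) = 0" if "p \<in> P" "t \<in> param_dom n" for p t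
      by (rule analytic_continuation[OF holomorphic_on_poly_poly[OF param_x_holomorphic param_y_holomorphic]
            open_param_dom connected_param_dom _ one lim])
        (use that in \<open>auto simp: P \<Phi>_def\<close>)
    then show ?thesis by (auto simp: V P \<Phi>_def)
  qed
  have "solution_curve n y0 = A \<or> solution_curve n y0 = B"
    if AB: "algebraic_set A" "algebraic_set B" "solution_curve n y0 = A \<union> B" for A B
  proof -
    \<comment> \<open>A point of an open set is a limit point of it, and a limit point of a union of
      two sets is a limit point of one of them.\<close>
    have "1 islimpt param_dom n"
      using open_param_dom one by (simp add: interior_limit_point interior_open)
    moreover have "param_dom n = (param_dom n \<inter> \<Phi> -` A) \<union> (param_dom n \<inter> \<Phi> -` B)"
      using AB(3) V by blast
    ultimately have "1 islimpt (param_dom n \<inter> \<Phi> -` A) \<or> 1 islimpt (param_dom n \<inter> \<Phi> -` B)"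
      by (metis islimpt_Un)
    with full AB show ?thesis by blast
  qed
  then show ?thesis
    using algebraic_solution_curve[OF assms] one unfolding irreducible_algebraic_set_def V by blast
qed

text \<open>The parameter \<open>1\<close> represents the point \<open>(0, y0)\<close>, and
  \<open>param_x n y0\<close> is locally invertible there. Composing \<open>param_y n y0\<close>
  with the inverse gives the solution.\<close>

lemma local_solution_exists:
  assumes "n \<ge> 1" "y0 \<noteq> 0"
  shows "\<exists>f. local_solution n y0 f"
proof -
  have one: "1 \<in> param_dom n" by (simp add: param_dom_iff)
  obtain U g where U: "1 \<in> U" "U \<subseteq> param_dom n" "open (param_x n y0 ` U)"
    "g holomorphic_on param_x n y0 ` U" "\<And>t. t \<in> U \<Longrightarrow> g (param_x n y0 t) = t"
    using holomorphic_local_inverse[OF param_x_holomorphic open_param_dom one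
        deriv_param_x_neq_0[OF assms one]] by metis
  have x1: "param_x n y0 1 = 0" "param_y n y0 1 = y0"
    by (simp_all add: param_x_def param_y_def)
  then obtain r where r: "r > 0" "ball 0 r \<subseteq> param_x n y0 ` U"
    using U(1,3) by (metis imageI openE)
  define f where "f = param_y n y0 \<circ> g"
  have "f holomorphic_on param_x n y0 ` U"
    unfolding f_def using U
    by (intro holomorphic_on_compose holomorphic_on_subset[OF param_y_holomorphic]) auto
  moreover have "H n x (f x) = y0" if "x \<in> param_x n y0 ` U" for x
    using that U by (auto simp: f_def H_param[OF assms])
  ultimately have "branch n y0 (ball 0 r) f"
    using r by (auto simp: branch_def intro: holomorphic_on_subset)
  moreover have "f 0 = y0"
    using U(5)[OF U(1)] by (simp add: f_def x1)
  ultimately show ?thesis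
    using r branch_satisfies_ode[OF assms open_ball] unfolding local_solution_def by blast
qed

subsection \<open>Lifts over the real segment\<close>

text \<open>The real form of \<open>param_x\<close>, divided by its value at
  \<open>n / (n + 1)\<close>. For \<open>n \<ge> 1\<close> its maximum on the unit interval is
  therefore 1, and \<open>sing_point n y0\<close> becomes the only complex factor.\<close>

definition profile :: "nat \<Rightarrow> real \<Rightarrow> real"
  where "profile n t = t ^ n * (1 - t) / ((real n / (real n + 1)) ^ n * (1 - real n / (real n + 1)))"

lemma profile_denom_pos: "n \<ge> 1 \<Longrightarrow> (real n / (real n + 1)) ^ n * (1 - real n / (real n + 1)) > 0"
  by (intro mult_pos_pos zero_less_power divide_pos_pos) auto

lemma param_x_of_real:
  assumes "n \<ge> 1"
  shows "param_x n y0 (of_real t) = sing_point n y0 * of_real (profile n t)"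
proof -
  define m where "m = (real n / (real n + 1)) ^ n * (1 - real n / (real n + 1))"
  have m: "m \<noteq> 0" using profile_denom_pos[OF assms] by (metis less_irrefl m_def)
  have "sing_point n y0 = (2 * of_nat n + 1) * of_real m / y0"
    by (subst param_x_crit[OF assms, symmetric]) (simp add: param_x_def crit_def m_def)
  then show ?thesis
    using m by (simp add: param_x_def profile_def flip: m_def)
qed

lemma profile_deriv:
  assumes "n \<ge> 1"
  shows "(profile n has_real_derivative t ^ (n - 1) * (real n - (real n + 1) * t) /
    ((real n / (real n + 1)) ^ n * (1 - real n / (real n + 1)))) (at t)"
proof -
  obtain m where m: "n = Suc m" using assms by (cases n) auto
  have "((\<lambda>t. t ^ n * (1 - t)) has_real_derivative t ^ (n - 1) * (real n - (real n + 1) * t)) (at t)"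
    by (rule derivative_eq_intros refl)+ (simp add: m algebra_simps)
  then show ?thesis
    unfolding profile_def by (rule DERIV_cdivide)
qed

lemma continuous_on_profile: "n \<ge> 1 \<Longrightarrow> continuous_on S (profile n)"
  by (intro continuous_at_imp_continuous_on ballI DERIV_isCont[OF profile_deriv])

lemma profile_increasing:
  assumes "n \<ge> 1" "0 \<le> s" "s < t" "t \<le> real n / (real n + 1)"
  shows "profile n s < profile n t"
proof (rule DERIV_pos_imp_increasing_open[OF assms(3) _ continuous_on_profile[OF assms(1)]])
  fix x assume x: "s < x" "x < t"
  then have "x < real n / (real n + 1)" "x > 0"
    using assms by auto
  then have "real n - (real n + 1) * x > 0" "x > 0"
    by (auto simp: field_simps)
  then show "\<exists>y. (profile n has_real_derivative y) (at x) \<and> 0 < y"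
    by - (rule exI, rule conjI, rule profile_deriv[OF assms(1)],
        intro divide_pos_pos mult_pos_pos zero_less_power profile_denom_pos[OF assms(1)])
qed

lemma profile_decreasing:
  assumes "n \<ge> 1" "s < t" "real n / (real n + 1) \<le> s"
  shows "profile n t < profile n s"
proof (rule DERIV_neg_imp_decreasing_open[OF assms(2) _ continuous_on_profile[OF assms(1)]])
  fix x assume x: "s < x" "x < t"
  have "real n / (real n + 1) < x" using x assms by simp
  then have "real n - (real n + 1) * x < 0" by (simp add: field_simps)
  moreover have "x > 0"
    using \<open>real n / (real n + 1) < x\<close> by (rule order.strict_trans1[rotated]) simp
  ultimately show "\<exists>y. (profile n has_real_derivative y) (at x) \<and> y < 0"
    by - (rule exI, rule conjI, rule profile_deriv[OF assms(1)],
        intro divide_neg_pos mult_pos_neg zero_less_power profile_denom_pos[OF assms(1)])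
qed

text \<open>The image of the interval is connected, so it contains everything between 0 and 1; a
  continuous injection on a compact interval has a continuous inverse. Stated with injectivity, it
  serves both the rising and the falling piece of \<open>profile\<close>.\<close>

lemma inverse_on_unit_interval:
  fixes q :: "real \<Rightarrow> real"
  assumes q: "continuous_on {a..b} q" "inj_on q {a..b}" and ends: "0 \<in> q ` {a..b}" "1 \<in> q ` {a..b}"
  obtains g where "continuous_on {0..1} g" "\<And>s. s \<in> {0..1} \<Longrightarrow> g s \<in> {a..b} \<and> q (g s) = s"
proof -
  have sub: "{0..1} \<subseteq> q ` {a..b}"
    using ends by (intro connected_contains_Icc connected_continuous_image q(1)) auto
  show ?thesis
  proof
    show "continuous_on {0..1} (the_inv_into {a..b} q)"
      using continuous_on_inv_into[OF q(1) _ q(2)] sub continuous_on_subset by blast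
    show "the_inv_into {a..b} q s \<in> {a..b} \<and> q (the_inv_into {a..b} q s) = s" if "s \<in> {0..1}" for s
      using that sub the_inv_into_into[OF q(2) _ order_refl] f_the_inv_into_f[OF q(2)] by blast
  qed
qed

text \<open>The paths \<open>u\<close> and \<open>l\<close> invert \<open>profile\<close> on the
  pieces above and below \<open>n / (n + 1)\<close>: the sheet of the way out and that of the way
  back. They meet at the fold point \<open>crit n\<close>, and \<open>l\<close> reaches the excluded
  parameter \<open>0\<close> at \<open>s = 0\<close>.\<close>

lemma real_lifts:
  assumes "n \<ge> 1"
  obtains u l :: "real \<Rightarrow> complex" where
    "continuous_on {0..1} u" "continuous_on {0..1} l"
    "u 0 = 1" "u 1 = crit n" "l 0 = 0" "l 1 = crit n"
    "\<And>y0 s. s \<in> {0..1} \<Longrightarrow> param_x n y0 (u s) = sing_point n y0 * of_real s"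
    "\<And>y0 s. s \<in> {0..1} \<Longrightarrow> param_x n y0 (l s) = sing_point n y0 * of_real s"
    "\<And>s. s \<in> {0..<1} \<Longrightarrow> u s \<in> param_dom n"
    "\<And>s. s \<in> {0<..<1} \<Longrightarrow> l s \<in> param_dom n"
    "\<And>s. s \<in> {0..<1} \<Longrightarrow> u s \<noteq> l s"
proof -
  define c where "c = real n / (real n + 1)"
  have c: "0 < c" "c < 1" using assms by (auto simp: c_def)
  have crit: "crit n = of_real c" by (simp add: crit_def c_def)
  have vals: "profile n 0 = 0" "profile n 1 = 0" "profile n c = 1"
    using assms profile_denom_pos[OF assms] by (simp_all add: profile_def c_def)
  have inj: "inj_on (profile n) {c..1}" "inj_on (profile n) {0..c}"
    unfolding inj_on_def
    by (metis profile_decreasing[OF assms] profile_increasing[OF assms] c_def atLeastAtMost_iff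
        less_irrefl linorder_neqE_linordered_idom)+
  have ends: "0 \<in> profile n ` {c..1}" "1 \<in> profile n ` {c..1}"
    "0 \<in> profile n ` {0..c}" "1 \<in> profile n ` {0..c}"
    using c vals by (simp_all add: image_iff) (metis atLeastAtMost_iff less_imp_le order_refl)+
  obtain u where u: "continuous_on {0..1} u" "\<And>s. s \<in> {0..1} \<Longrightarrow> u s \<in> {c..1} \<and> profile n (u s) = s"
    using inverse_on_unit_interval[OF continuous_on_profile[OF assms] inj(1) ends(1,2)] by blast
  obtain l where l: "continuous_on {0..1} l" "\<And>s. s \<in> {0..1} \<Longrightarrow> l s \<in> {0..c} \<and> profile n (l s) = s"
    using inverse_on_unit_interval[OF continuous_on_profile[OF assms] inj(2) ends(3,4)] by blast
  have u_neq: "u s \<noteq> 0" "u s \<noteq> c" if "s \<in> {0..<1}" for s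
    using u(2)[of s] that c vals by auto
  have l_neq: "l s \<noteq> c" "s \<noteq> 0 \<Longrightarrow> l s \<noteq> 0" if "s \<in> {0..<1}" for s
    using l(2)[of s] that c vals by auto
  show ?thesis
  proof
    show "continuous_on {0..1} (\<lambda>s. complex_of_real (u s))" "continuous_on {0..1} (\<lambda>s. complex_of_real (l s))"
      by (intro continuous_intros u l)+
    show "of_real (u 0) = (1 :: complex)" "of_real (u 1) = crit n"
      using inj_onD[OF inj(1), of "u 0" 1] inj_onD[OF inj(1), of "u 1" c] u(2)[of 0] u(2)[of 1] vals c
      by (auto simp: crit)
    show "of_real (l 0) = (0 :: complex)" "of_real (l 1) = crit n"
      using inj_onD[OF inj(2), of "l 0" 0] inj_onD[OF inj(2), of "l 1" c] l(2)[of 0] l(2)[of 1] vals c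
      by (auto simp: crit)
    show "param_x n y0 (of_real (u s)) = sing_point n y0 * of_real s" if "s \<in> {0..1}" for y0 s
      using u(2)[OF that] by (simp add: param_x_of_real[OF assms])
    show "param_x n y0 (of_real (l s)) = sing_point n y0 * of_real s" if "s \<in> {0..1}" for y0 s
      using l(2)[OF that] by (simp add: param_x_of_real[OF assms])
    show "of_real (u s) \<in> param_dom n" if "s \<in> {0..<1}" for s
      using u_neq[OF that] by (simp add: param_dom_def crit)
    show "of_real (l s) \<in> param_dom n" if "s \<in> {0<..<1}" for s
      using l_neq[of s] that by (simp add: param_dom_def crit)
    show "of_real (u s) \<noteq> (of_real (l s) :: complex)" if "s \<in> {0..<1}" for s
      using u_neq[OF that] u(2)[of s] l(2)[of s] that by force
  qed
qed

subsection \<open>Branches near zero\<close>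

text \<open>Division by \<open>p\<close> turns the slit into the cut of \<open>Ln\<close>.\<close>

lemma slit_disc_iff:
  assumes "p \<noteq> 0"
  shows "x \<in> slit_disc p r \<longleftrightarrow> cmod x < r \<and> x / p \<notin> \<real>\<^sub>\<le>\<^sub>0"
proof -
  have "x \<in> {of_real t * p | t. t \<le> 0} \<longleftrightarrow> x / p \<in> \<real>\<^sub>\<le>\<^sub>0"
    using assms by (auto simp: nonpos_Reals_def field_simps)
  then show ?thesis by (auto simp: slit_disc_def)
qed

lemma open_slit_disc:
  assumes "p \<noteq> 0"
  shows "open (slit_disc p r)"
proof -
  have "slit_disc p r = ball 0 r \<inter> (\<lambda>x. x / p) -` (- \<real>\<^sub>\<le>\<^sub>0)"
    by (auto simp: slit_disc_iff[OF assms])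
  moreover have "open \<dots>"
    using assms by (intro open_Int open_ball open_vimage continuous_intros open_Compl closed_nonpos_Reals_complex) auto
  ultimately show ?thesis by simp
qed

text \<open>For \<open>n \<ge> 1\<close> these are the \<open>n\<close>-th roots of
  \<open>x\<close>, indexed by \<open>i\<close>. The logarithm is taken of \<open>x / p\<close> to
  place its cut on the slit, and the constant root of \<open>p\<close> compensates for the
  division.\<close>

definition slit_root :: "complex \<Rightarrow> nat \<Rightarrow> nat \<Rightarrow> complex \<Rightarrow> complex"
  where "slit_root p n i x = exp (Ln p / of_nat n) * exp (Ln (x / p) / of_nat n) *
    exp (2 * of_real pi * \<i> * of_nat i / of_nat n)"

lemma slit_root_neq_0 [simp]: "slit_root p n i x \<noteq> 0"
  by (simp add: slit_root_def)

lemma slit_root_power: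
  assumes "n \<ge> 1" "p \<noteq> 0" "x \<noteq> 0"
  shows "slit_root p n i x ^ n = x"
proof -
  have "exp (2 * of_real pi * \<i> * of_nat i) = (1 :: complex)"
    using complex_root_unity_eq_1[of 1 i] by simp
  then show ?thesis
    using assms by (simp add: slit_root_def power_mult_distrib exp_divide_power_eq)
qed

lemma slit_root_inj:
  assumes "n \<ge> 1" "slit_root p n i x = slit_root p n j x" "i < n" "j < n"
  shows "i = j"
  using assms complex_root_unity_eq[OF assms(1), of i j] by (simp add: slit_root_def)

lemma slit_root_holomorphic:
  assumes "p \<noteq> 0"
  shows "slit_root p n i holomorphic_on slit_disc p r"
proof (cases "n = 0")
  case True
  then show ?thesis unfolding slit_root_def by simp
next
  case False
  then show ?thesis
    unfolding slit_root_def using assms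
    by (auto intro!: holomorphic_intros simp: slit_disc_iff)
qed

lemma slit_root_norm:
  assumes "n \<ge> 1" "p \<noteq> 0" "x \<noteq> 0"
  shows "cmod (slit_root p n i x) = root n (cmod x)"
proof -
  have "cmod (slit_root p n i x) ^ n = cmod x"
    using slit_root_power[OF assms] by (metis norm_power)
  then show ?thesis using assms(1) by (metis real_root_pos2 norm_ge_zero less_eq_Suc_le One_nat_def)
qed

text \<open>The quotient \<open>b / a\<close> is an \<open>n\<close>-th root of unity. Adding
  \<open>n\<close> to its exponent leaves it unchanged and makes the number of turns
  positive.\<close>

lemma root_quotient_turns:
  fixes a b :: complex
  assumes "n \<ge> 1" "a ^ n = b ^ n" "a \<noteq> 0"
  obtains k where "k \<ge> 1" "b = a * exp (2 * of_real pi * \<i> * of_nat k / of_nat n)"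
proof -
  have "(b / a) ^ n = 1" using assms(3) by (simp add: power_divide flip: assms(2))
  then obtain j where j: "b / a = exp (2 * of_real pi * \<i> * of_nat j / of_nat n)"
    using complex_roots_unity[OF assms(1)] by blast
  also have "\<dots> = exp (2 * of_real pi * \<i> * of_nat (j + n) / of_nat n)"
    unfolding complex_root_unity_eq[OF assms(1)] by simp
  finally have "b = a * exp (2 * of_real pi * \<i> * of_nat (j + n) / of_nat n)"
    using assms(3) by (metis nonzero_eq_divide_eq mult.commute)
  then show ?thesis by (rule that[rotated]) (use assms in simp)
qed

text \<open>The parameters over \<open>x\<close> are the roots of a polynomial of degree at most
  \<open>n + 1\<close>, which is nonzero because its value at \<open>0\<close> is
  \<open>- y0 x\<close>. The bound serves to show that the branches found are all of them.\<close>

lemma param_x_fibre: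
  assumes "n \<ge> 1" "y0 \<noteq> 0" "x \<noteq> 0"
  shows "finite {t. param_x n y0 t = x}" "card {t. param_x n y0 t = x} \<le> n + 1"
proof -
  define P where "P = monom (2 * of_nat n + 1) n * [:1, - 1:] - [:y0 * x:]"
  have "param_x n y0 t = x \<longleftrightarrow> poly P t = 0" for t
    using assms by (auto simp: P_def param_x_def poly_monom field_simps)
  then have eq: "{t. param_x n y0 t = x} = {t. poly P t = 0}" by simp
  have "poly P 0 \<noteq> 0" using assms by (simp add: P_def poly_monom power_0_left)
  then have "P \<noteq> 0" by auto
  have "degree (monom (2 * of_nat n + 1) n * [:1, - 1:] :: complex poly) \<le> n + 1"
    by (rule order_trans[OF degree_mult_le]) (simp add: degree_monom_eq)
  then have "degree P \<le> n + 1"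
    unfolding P_def by (intro degree_diff_le) auto
  with \<open>P \<noteq> 0\<close> show "finite {t. param_x n y0 t = x}" "card {t. param_x n y0 t = x} \<le> n + 1"
    unfolding eq by (auto intro: poly_roots_finite order_trans[OF card_poly_roots_bound])
qed

text \<open>The denominator of \<open>param_y\<close> tends to 0 along \<open>f\<close> without
  vanishing.\<close>

lemma param_y_at_infinity:
  assumes "n \<ge> 1" "y0 \<noteq> 0" "(f \<longlongrightarrow> 0) F" "\<forall>\<^sub>F x in F. f x \<in> param_dom n"
  shows "filterlim (\<lambda>x. param_y n y0 (f x)) at_infinity F"
proof -
  define d where "d t = t ^ n * ((of_nat n + 1) * t - of_nat n)" for t :: complex
  have "((\<lambda>x. d (f x)) \<longlongrightarrow> 0 ^ n * ((of_nat n + 1) * 0 - of_nat n)) F"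
    unfolding d_def by (intro tendsto_intros assms)
  then have "((\<lambda>x. d (f x)) \<longlongrightarrow> 0) F"
    using assms(1) by (simp add: power_0_left)
  moreover have "\<forall>\<^sub>F x in F. d (f x) \<noteq> 0"
    using assms(4) by eventually_elim (auto simp: d_def param_dom_iff)
  ultimately have "filterlim (\<lambda>x. d (f x)) (at 0) F"
    by (simp add: filterlim_at)
  then have "filterlim (\<lambda>x. inverse (d (f x))) at_infinity F"
    by (rule filterlim_compose[OF filterlim_inverse_at_infinity])
  then have "filterlim (\<lambda>x. y0 * inverse (d (f x))) at_infinity F"
    using assms(2) by (intro tendsto_mult_filterlim_at_infinity[OF tendsto_const])
  then show ?thesis by (simp add: param_y_def d_def divide_inverse)
qed

text \<open>The bound \<open>r \<le> \<delta> ^ n\<close> puts the \<open>n\<close>-th roots of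
  \<open>x\<close> into the disc of the chart. They give \<open>n\<close> parameters within 1/2 of
  \<open>0\<close>, while that of \<open>f x\<close> is within 1/2 of \<open>1\<close>. As there are
  at most \<open>n + 1\<close> parameters over \<open>x\<close>, these are all.\<close>

lemma remaining_branches_chart:
  assumes "n \<ge> 1" "y0 \<noteq> 0" "p \<noteq> 0"
    and chart: "power_chart (param_x n y0) 0 n 0 U h g \<delta>" "U - {0} \<subseteq> param_dom n" "U \<subseteq> ball 0 (1/2)"
    and r: "r \<le> \<delta> ^ n"
    and f: "\<forall>x\<in>ball 0 r. H n x (f x) = y0" "\<forall>x\<in>ball 0 r. param n x (f x) \<in> ball 1 (1/2)"
  shows "remaining_branches n y0 f (slit_disc p r) (\<lambda>i x. param_y n y0 (g (slit_root p n i x)))"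
    and "\<And>x i. x \<in> slit_disc p r \<Longrightarrow> g (slit_root p n i x) \<in> param_dom n"
    and "\<And>x i. x \<in> slit_disc p r \<Longrightarrow> param_x n y0 (g (slit_root p n i x)) = x"
    and "\<And>i. (\<lambda>x. g (slit_root p n i x)) holomorphic_on slit_disc p r"
proof -
  define D where "D = slit_disc p r"
  define B where "B i x = g (slit_root p n i x)" for i x
  have \<delta>: "\<delta> > 0" "h 0 = 0" "g holomorphic_on ball 0 \<delta>" "0 \<in> U" "\<And>z. z \<in> U \<Longrightarrow> g (h z) = z"
    using chart(1) by (auto simp: power_chart_def)
  have D: "x \<noteq> 0" "cmod x < r" "x \<in> ball 0 r" if "x \<in> D" for x
    using that assms(3) by (auto simp: D_def slit_disc_iff)
  have root: "slit_root p n i x \<in> ball 0 \<delta>" if "x \<in> D" for i x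
  proof -
    have "cmod (slit_root p n i x) ^ n = cmod x"
      using slit_root_power[OF assms(1,3)] D(1)[OF that] by (metis norm_power)
    also have "\<dots> < \<delta> ^ n" using D(2)[OF that] r by simp
    finally show ?thesis using \<delta>(1) by (simp add: power_less_imp_less_base)
  qed
  note inv = power_chart_inverse[OF chart(1) root]
  have BU: "B i x \<in> U" "B i x \<noteq> 0" "B i x \<in> param_dom n" if "x \<in> D" for i x
  proof -
    show "B i x \<in> U" using inv(1)[OF that] by (simp add: B_def)
    show "B i x \<noteq> 0" using inv(2)[OF that, of i] \<delta>(2) by (metis B_def slit_root_neq_0)
    with \<open>B i x \<in> U\<close> chart(2) show "B i x \<in> param_dom n" by blast
  qed
  have XB: "param_x n y0 (B i x) = x" if "x \<in> D" for i x
    using inv(3)[OF that] slit_root_power[OF assms(1,3) D(1)[OF that]] by (simp add: B_def)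
  have Bhol: "B i holomorphic_on D" for i
    unfolding B_def D_def
    using holomorphic_on_compose_gen[OF slit_root_holomorphic[OF assms(3)] \<delta>(3)] root
    by (auto simp: comp_def D_def image_subset_iff)
  show "\<And>x i. x \<in> slit_disc p r \<Longrightarrow> g (slit_root p n i x) \<in> param_dom n"
    and "\<And>x i. x \<in> slit_disc p r \<Longrightarrow> param_x n y0 (g (slit_root p n i x)) = x"
    and "\<And>i. (\<lambda>x. g (slit_root p n i x)) holomorphic_on slit_disc p r"
    using BU(3) XB Bhol by (simp_all add: B_def[abs_def] D_def)
  \<comment> \<open>Since \<open>param n x\<close> recovers the parameter, distinct parameters over
    one \<open>x\<close> give distinct values of \<open>y\<close>.\<close>
  have param_B: "param n x (param_y n y0 (B i x)) = B i x" if "x \<in> D" for i x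
    using param_param[OF assms(1,2) BU(3)[OF that]] by (simp add: XB[OF that])
  have branch: "branch n y0 D (\<lambda>x. param_y n y0 (B i x))" for i
  proof -
    have "(\<lambda>x. param_y n y0 (B i x)) holomorphic_on D"
      using holomorphic_on_compose_gen[OF Bhol param_y_holomorphic] BU(3)
      by (auto simp: comp_def image_subset_iff)
    moreover have "H n x (param_y n y0 (B i x)) = y0" if "x \<in> D" for x
      using H_param[OF assms(1,2) BU(3)[OF that]] by (simp add: XB[OF that])
    ultimately show ?thesis by (simp add: branch_def)
  qed
  have inD: "\<forall>\<^sub>F x in at 0 within D. x \<in> D" by (simp add: eventually_at_filter)
  have lim: "filterlim (\<lambda>x. param_y n y0 (B i x)) at_infinity (at 0 within D)" for i
  proof (rule param_y_at_infinity[OF assms(1,2)])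
    have "((\<lambda>x. root n (cmod x)) \<longlongrightarrow> root n (cmod 0)) (at 0 within D)"
      by (intro tendsto_intros)
    moreover have "\<forall>\<^sub>F x in at 0 within D. root n (cmod x) = cmod (slit_root p n i x)"
      using inD by eventually_elim (simp add: slit_root_norm[OF assms(1,3) D(1)])
    ultimately have "((\<lambda>x. cmod (slit_root p n i x)) \<longlongrightarrow> root n (cmod 0)) (at 0 within D)"
      by (rule Lim_transform_eventually)
    then have "(slit_root p n i \<longlongrightarrow> 0) (at 0 within D)"
      by (simp add: tendsto_norm_zero_iff)
    moreover have "isCont g 0"
      using \<delta>(1) by (intro holomorphic_on_imp_isCont[OF \<delta>(3)]) auto
    ultimately have "((\<lambda>x. g (slit_root p n i x)) \<longlongrightarrow> g 0) (at 0 within D)"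
      by (metis isCont_tendsto_compose)
    moreover have "g 0 = 0" using \<delta> by metis
    ultimately show "(B i \<longlongrightarrow> 0) (at 0 within D)" by (simp add: B_def[abs_def])
    show "\<forall>\<^sub>F x in at 0 within D. B i x \<in> param_dom n"
      using inD by eventually_elim (simp add: BU)
  qed
  have fibre: "inj_on (\<lambda>i. param_y n y0 (B i x)) {..<n} \<and>
      f x \<notin> (\<lambda>i. param_y n y0 (B i x)) ` {..<n} \<and>
      {y. (x, y) \<in> solution_curve n y0} = insert (f x) ((\<lambda>i. param_y n y0 (B i x)) ` {..<n})"
    if x: "x \<in> D" for x
  proof -
    define A where "A = param n x (f x)"
    have A: "A \<in> param_dom n" "param_x n y0 A = x" "param_y n y0 A = f x"
      using bspec[OF f(1) D(3)[OF x]] by (simp_all add: A_def param_in_dom[OF assms(1,2)]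
        param_x_param[OF assms(1,2)] param_y_param[OF assms(1,2)])
    have injB: "inj_on (\<lambda>i. B i x) {..<n}"
    proof (rule inj_onI)
      fix i j assume ij: "i \<in> {..<n}" "j \<in> {..<n}" "B i x = B j x"
      then have "slit_root p n i x = slit_root p n j x"
        using inv(2)[OF x] by (metis B_def)
      with ij show "i = j" using slit_root_inj[OF assms(1)] by blast
    qed
    have AB: "A \<noteq> B i x" for i
    proof
      assume "A = B i x"
      then have "dist 1 A < 1/2" "dist 0 A < 1/2"
        using bspec[OF f(2) D(3)[OF x]] BU(1)[OF x, of i] chart(3) by (auto simp: A_def)
      then have "dist 0 (1 :: complex) < 1" by (metis dist_triangle_half_l dist_commute)
      then show False by simp
    qed
    have "insert A ((\<lambda>i. B i x) ` {..<n}) \<subseteq> {t. param_x n y0 t = x}"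
      using A(2) XB[OF x] by auto
    moreover have "card {t. param_x n y0 t = x} \<le> card (insert A ((\<lambda>i. B i x) ` {..<n}))"
      using AB param_x_fibre(2)[OF assms(1,2) D(1)[OF x]] card_image[OF injB]
      by (subst card_insert_disjoint) auto
    ultimately have roots: "insert A ((\<lambda>i. B i x) ` {..<n}) = {t. param_x n y0 t = x}"
      using param_x_fibre(1)[OF assms(1,2) D(1)[OF x]] by (metis card_seteq)
    have "{y. (x, y) \<in> solution_curve n y0} = param_y n y0 ` (param_dom n \<inter> {t. param_x n y0 t = x})"
      unfolding solution_curve_eq[OF assms(1,2)] by auto
    also have "param_dom n \<inter> {t. param_x n y0 t = x} = insert A ((\<lambda>i. B i x) ` {..<n})"
      unfolding roots[symmetric] using A(1) BU(3)[OF x] by auto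
    finally have "{y. (x, y) \<in> solution_curve n y0} = insert (f x) ((\<lambda>i. param_y n y0 (B i x)) ` {..<n})"
      by (simp add: A(3) image_image)
    moreover have "inj_on (\<lambda>i. param_y n y0 (B i x)) {..<n}"
      by (rule inj_onI) (metis param_B[OF x] inj_onD[OF injB])
    moreover have "f x \<notin> (\<lambda>i. param_y n y0 (B i x)) ` {..<n}"
      using AB param_B[OF x] unfolding A_def by force
    ultimately show ?thesis by blast
  qed
  show "remaining_branches n y0 f (slit_disc p r) (\<lambda>i x. param_y n y0 (g (slit_root p n i x)))"
    unfolding remaining_branches_def
    using branch lim fibre by (simp add: B_def D_def)
qed

subsection \<open>Continuation along the loop\<close>

text \<open>At \<open>0\<close> the cofactor of \<open>t^n\<close> in \<open>param_x\<close> is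
  nonzero. The radius 1/2 keeps the chart apart from the disc of that radius around the parameter
  \<open>1\<close> of the regular branch.\<close>

lemma power_chart_zero:
  assumes "n \<ge> 1" "y0 \<noteq> 0"
  obtains U h g \<delta> where "power_chart (param_x n y0) 0 n 0 U h g \<delta>" "U - {0} \<subseteq> param_dom n" "U \<subseteq> ball 0 (1/2)"
proof -
  define S where "S = ball 0 (1/2) - {crit n}"
  define G where "G t = (2 * of_nat n + 1) * (1 - t) / y0" for t
  have "crit n \<noteq> 0" using assms by (simp add: crit_def)
  have S: "open S" "0 \<in> S" using \<open>crit n \<noteq> 0\<close> by (auto simp: S_def)
  have G: "G holomorphic_on S" "G 0 \<noteq> 0"
    unfolding G_def using assms by (auto intro!: holomorphic_intros)
  have Q: "param_x n y0 z = 0 + (z - 0) ^ n * G z" for z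
    by (simp add: param_x_def G_def)
  from power_chart_exists[OF G(1) S G(2) Q] assms
  obtain U h g \<delta> where "U \<subseteq> S" "power_chart (param_x n y0) 0 n 0 U h g \<delta>"
    by (metis less_eq_Suc_le One_nat_def)
  then show ?thesis by (intro that[of U h g \<delta>]) (auto simp: S_def param_dom_def)
qed

text \<open>At \<open>crit n\<close> the first derivative of \<open>param_x\<close> vanishes and the
  second does not, so \<open>param_x\<close> takes its critical value there with order exactly
  two.\<close>

lemma power_chart_crit:
  assumes "n \<ge> 1" "y0 \<noteq> 0"
  obtains U h g \<delta> where "power_chart (param_x n y0) (sing_point n y0) 2 (crit n) U h g \<delta>"
    "U - {crit n} \<subseteq> param_dom n"
proof -
  have crit: "crit n \<noteq> 0" using assms by (simp add: crit_def)
  have critN: "(of_nat n + 1) * crit n = of_nat n" by (simp add: crit_iff)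
  have 1: "deriv (param_x n y0) = (\<lambda>t. (2 * of_nat n + 1) * t ^ (n - 1) * (of_nat n - (of_nat n + 1) * t) / y0)"
    using deriv_param_x[OF assms(1)] by blast
  have "((\<lambda>t. (2 * of_nat n + 1) * t ^ (n - 1) * (of_nat n - (of_nat n + 1) * t)) has_field_derivative
      (2 * of_nat n + 1) * crit n ^ (n - 1) * (- (of_nat n + 1))) (at (crit n))"
    by (rule derivative_eq_intros refl)+ (simp add: critN)
  from DERIV_cdivide[OF this, of y0]
  have 2: "deriv (deriv (param_x n y0)) (crit n) = (2 * of_nat n + 1) * crit n ^ (n - 1) * (- (of_nat n + 1)) / y0"
    unfolding 1 by (rule DERIV_imp_deriv)
  have d1: "(deriv ^^ i) (param_x n y0) (crit n) = 0" if "0 < i" "i < 2" for i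
  proof -
    have "i = Suc 0" using that by linarith
    then show ?thesis by (simp add: 1 critN)
  qed
  have d2: "(deriv ^^ 2) (param_x n y0) (crit n) \<noteq> 0"
    using crit assms by (simp add: numeral_2_eq_2 2 del: minus_add_distrib)
  obtain G r where G: "0 < r" "G holomorphic_on ball (crit n) r"
    "\<And>w. w \<in> ball (crit n) r \<Longrightarrow> param_x n y0 w - param_x n y0 (crit n) = (w - crit n)\<^sup>2 * G w"
    "\<And>w. w \<in> ball (crit n) r \<Longrightarrow> G w \<noteq> 0"
    by (rule holomorphic_factor_order_of_zero[OF param_x_holomorphic[of n y0 UNIV] open_UNIV UNIV_I _ d2 d1])
      auto
  define S where "S = ball (crit n) r - {0}"
  have S: "open S" "crit n \<in> S" using crit G(1) by (auto simp: S_def)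
  have GS: "G holomorphic_on S" "G (crit n) \<noteq> 0"
    using G by (auto simp: S_def intro: holomorphic_on_subset)
  have Q: "param_x n y0 w = sing_point n y0 + (w - crit n)\<^sup>2 * G w" if "w \<in> S" for w
    using G(3)[of w] that by (simp add: S_def param_x_crit[OF assms(1)] algebra_simps)
  from power_chart_exists[OF GS(1) S GS(2) Q]
  obtain U h g \<delta> where "U \<subseteq> S" "power_chart (param_x n y0) (sing_point n y0) 2 (crit n) U h g \<delta>"
    by (metis pos2)
  then show ?thesis by (intro that[of U h g \<delta>]) (auto simp: S_def param_dom_def)
qed

text \<open>A lift of the whole segment is reparametrized to run between two of its points,
  backwards if \<open>\<beta> < \<alpha>\<close>. The interval \<open>I\<close> leaves out the ends
  where the lift quits \<open>W\<close>.\<close>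

lemma lifts_linepath:
  assumes g: "continuous_on {0..1} g" "\<And>s. s \<in> {0..1} \<Longrightarrow> Q (g s) = p * of_real s"
    and I: "convex I" "I \<subseteq> {0..1}" "\<And>s. s \<in> I \<Longrightarrow> g s \<in> W" "\<alpha> \<in> I" "\<beta> \<in> I"
  shows "lifts Q W (linepath (p * of_real \<alpha>) (p * of_real \<beta>)) (g \<circ> linepath \<alpha> \<beta>)"
proof -
  have img: "linepath \<alpha> \<beta> s \<in> I" if "s \<in> {0..1}" for s
    unfolding linepath_def using that convexD[OF I(1,4,5), of "1 - s" s] by simp
  have "continuous_on {0..1} (g \<circ> linepath \<alpha> \<beta>)"
    using img I(2)
    by (intro continuous_on_compose continuous_on_subset[OF g(1)] continuous_on_linepath) blast
  moreover have "Q (g (linepath \<alpha> \<beta> s)) = linepath (p * of_real \<alpha>) (p * of_real \<beta>) s" if "s \<in> {0..1}" for s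
  proof -
    have "Q (g (linepath \<alpha> \<beta> s)) = p * of_real (linepath \<alpha> \<beta> s)"
      using img[OF that] I(2) g(2) by blast
    then show ?thesis by (simp add: linepath_def scaleR_conv_of_real algebra_simps)
  qed
  ultimately show ?thesis
    using img I(3) by (auto simp: lifts_def path_def path_image_def)
qed

lemma of_real_times_sgn: "of_real r * sgn p = p * of_real (r / cmod p)" for p :: complex
  by (simp add: sgn_eq)

lemma continuation_of_local_solution:
  assumes "n \<ge> 1" "y0 \<noteq> 0" "local_solution n y0 f"
  defines "p \<equiv> sing_point n y0"
  shows "\<exists>r>0. \<exists>G. remaining_branches n y0 f (slit_disc p r) G \<and>
    (\<forall>\<rho> \<epsilon>. 0 < \<rho> \<and> \<rho> < r \<and> 0 < \<epsilon> \<and> \<epsilon> < r \<longrightarrow>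
      (\<forall>i<n. \<exists>k\<ge>1. continues_along (omega p \<rho> \<epsilon> +++ turns 0 (base_point p \<epsilon>) k) f (G i)))"
proof -
  have p: "p \<noteq> 0" "cmod p > 0" using sing_point_neq_0[OF assms(1,2)] by (simp_all add: p_def)
  obtain R where R: "R > 0" "f 0 = y0" "branch n y0 (ball 0 R) f"
    using assms(3) by (auto simp: local_solution_def)
  \<comment> \<open>The parameter of \<open>f\<close>, a local inverse of \<open>param_x\<close>
    with value \<open>1\<close> at \<open>0\<close>: it selects the initial point of the
    lift.\<close>
  define A where "A x = param n x (f x)" for x
  have Hf: "H n x (f x) = y0" if "x \<in> ball 0 R" for x
    using R(3) that by (simp add: branch_def)
  have A0: "A 0 = 1" by (simp add: A_def param_def)
  have "A holomorphic_on ball 0 R"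
    unfolding A_def by (rule param_branch_holomorphic[OF assms(1,2) R(3)])
  then have A_cont: "isCont A 0"
    using R(1) by (intro holomorphic_on_imp_isCont[of A "ball 0 R"]) auto
  then obtain R' where R': "R' > 0" "\<And>x. dist x 0 < R' \<Longrightarrow> dist (A x) (A 0) < 1/2"
    unfolding continuous_at_eps_delta by (metis half_gt_zero zero_less_one)

  obtain u l where ul: "continuous_on {0..1} u" "continuous_on {0..1} l"
    "u 0 = 1" "u 1 = crit n" "l 0 = 0" "l 1 = crit n"
    "\<And>s. s \<in> {0..1} \<Longrightarrow> param_x n y0 (u s) = p * of_real s"
    "\<And>s. s \<in> {0..1} \<Longrightarrow> param_x n y0 (l s) = p * of_real s"
    "\<And>s. s \<in> {0..<1} \<Longrightarrow> u s \<in> param_dom n"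
    "\<And>s. s \<in> {0<..<1} \<Longrightarrow> l s \<in> param_dom n"
    "\<And>s. s \<in> {0..<1} \<Longrightarrow> u s \<noteq> l s"
    by (rule real_lifts[OF assms(1)]) (simp add: p_def)
  obtain U0 h0 g0 \<delta>0 where chart0: "power_chart (param_x n y0) 0 n 0 U0 h0 g0 \<delta>0"
    "U0 - {0} \<subseteq> param_dom n" "U0 \<subseteq> ball 0 (1/2)"
    using power_chart_zero[OF assms(1,2)] by metis
  obtain U1 h1 g1 \<delta>1 where chart1: "power_chart (param_x n y0) p 2 (crit n) U1 h1 g1 \<delta>1"
    "U1 - {crit n} \<subseteq> param_dom n"
    using power_chart_crit[OF assms(1,2)] unfolding p_def by metis
  have U: "open U0" "0 \<in> U0" "\<delta>0 > 0" "\<And>z. z \<in> U0 \<Longrightarrow> g0 (h0 z) = z"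
      "\<And>z. z \<in> U0 \<Longrightarrow> param_x n y0 z = h0 z ^ n" "h0 0 = 0"
    "open U1" "crit n \<in> U1" "\<And>z. z \<in> U1 \<Longrightarrow> g1 (h1 z) = z"
      "\<And>z. z \<in> U1 \<Longrightarrow> param_x n y0 z = p + (h1 z)\<^sup>2"
    using chart0(1) chart1(1) by (auto simp: power_chart_def)
  have near: "\<exists>d>0. \<forall>s\<in>{0..1}. dist s a < d \<longrightarrow> g s \<in> V"
    if g: "continuous_on {0..1} g" "open V" "g a \<in> V" "a \<in> {0..1}"
    for g :: "real \<Rightarrow> complex" and V a
  proof -
    obtain e where e: "e > 0" "ball (g a) e \<subseteq> V" using g(2,3) openE by blast
    then obtain d where "d > 0" "\<forall>s\<in>{0..1}. dist s a < d \<longrightarrow> dist (g s) (g a) < e"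
      using g(1,4) unfolding continuous_on_iff by metis
    with e show ?thesis by (metis dist_commute mem_ball subsetD)
  qed
  obtain d0 where d0: "d0 > 0" "\<And>s. s \<in> {0..1} \<Longrightarrow> dist s 0 < d0 \<Longrightarrow> l s \<in> U0"
    using near[OF ul(2) U(1), of 0] U(2) ul(5) by auto
  obtain d1 where d1: "d1 > 0" "\<And>s. s \<in> {0..1} \<Longrightarrow> dist s 1 < d1 \<Longrightarrow> u s \<in> U1"
    using near[OF ul(1) U(7), of 1] U(8) ul(4) by auto
  obtain d2 where d2: "d2 > 0" "\<And>s. s \<in> {0..1} \<Longrightarrow> dist s 1 < d2 \<Longrightarrow> l s \<in> U1"
    using near[OF ul(2) U(7), of 1] U(8) ul(6) by auto

  \<comment> \<open>The bounds \<open>R\<close> and \<open>R'\<close> control \<open>f\<close> and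
    its parameter, and \<open>\<delta>0 ^ n\<close> the roots. The bound \<open>cmod p\<close> keeps
    both stopping points strictly between \<open>0\<close> and \<open>p\<close>, and the last three
    put the lifts over these points into the charts.\<close>
  define r where "r = Min {R, R', \<delta>0 ^ n, cmod p, cmod p * d0, cmod p * d1, cmod p * d2}"
  have r_le: "r \<le> R" "r \<le> R'" "r \<le> \<delta>0 ^ n" "r \<le> cmod p" "r \<le> cmod p * d0" "r \<le> cmod p * d1" "r \<le> cmod p * d2"
    unfolding r_def by (rule Min_le; blast)+
  have "r > 0"
    unfolding r_def using R(1) R'(1) U(3) p(2) d0(1) d1(1) d2(1) by (subst Min_gr_iff) auto
  define B where "B i x = g0 (slit_root p n i x)" for i x
  define G where "G i x = param_y n y0 (B i x)" for i x
  have f_small: "\<forall>x\<in>ball 0 r. H n x (f x) = y0" "\<forall>x\<in>ball 0 r. param n x (f x) \<in> ball 1 (1/2)"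
    using Hf R'(2) r_le(1,2) by (auto simp: A0[unfolded A_def] A_def dist_commute)
  note rem = remaining_branches_chart[OF assms(1,2) p(1) chart0 r_le(3) f_small]
  have remG: "remaining_branches n y0 f (slit_disc p r) G"
    using rem(1) by (simp add: G_def[abs_def] B_def)

  have "\<exists>k\<ge>1. continues_along (omega p \<rho> \<epsilon> +++ turns 0 (base_point p \<epsilon>) k) f (G i)"
    if \<rho>: "0 < \<rho>" "\<rho> < r" and \<epsilon>: "0 < \<epsilon>" "\<epsilon> < r" for \<rho> \<epsilon> i
  proof -
    \<comment> \<open>The circle around \<open>p\<close> starts at the fraction
      \<open>\<sigma>\<close> of the segment, and the way back stops at the fraction
      \<open>\<eta>\<close>.\<close>
    define \<sigma> where "\<sigma> = 1 - \<rho> / cmod p"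
    define \<eta> where "\<eta> = \<epsilon> / cmod p"
    have \<sigma>: "\<sigma> \<in> {0<..<1}" "1 - \<sigma> < d1" "1 - \<sigma> < d2"
      using \<rho> p(2) r_le by (auto simp: \<sigma>_def field_simps)
    have \<eta>: "\<eta> \<in> {0<..<1}" "\<eta> < d0"
      using \<epsilon> p(2) r_le by (auto simp: \<eta>_def field_simps)
    define a where "a = p * of_real \<sigma>"
    define b where "b = base_point p \<epsilon>"
    have a_eq: "p - of_real \<rho> * sgn p = a"
      unfolding of_real_times_sgn by (simp add: a_def \<sigma>_def algebra_simps)
    have b_eq: "b = p * of_real \<eta>"
      unfolding b_def base_point_def of_real_times_sgn by (simp add: \<eta>_def)
    have "b \<in> slit_disc p r"
      using p \<epsilon> \<eta>(1) unfolding slit_disc_iff[OF p(1)]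
      by (simp add: b_eq norm_mult) (simp add: \<eta>_def complex_nonpos_Reals_iff)
    have "b \<noteq> 0" using p \<eta>(1) by (simp add: b_eq)

    have uU: "u \<sigma> \<in> U1" "u \<sigma> \<noteq> crit n" "param_x n y0 (u \<sigma>) = a"
      using d1(2)[of \<sigma>] ul(7,9)[of \<sigma>] \<sigma> by (auto simp: dist_real_def a_def param_dom_def)
    have lU: "l \<sigma> \<in> U1" "param_x n y0 (l \<sigma>) = a"
      using d2(2)[of \<sigma>] ul(8)[of \<sigma>] \<sigma> by (auto simp: dist_real_def a_def)
    have lU0: "l \<eta> \<in> U0" "l \<eta> \<noteq> 0" "param_x n y0 (l \<eta>) = b"
      using d0(2)[of \<eta>] ul(8,10)[of \<eta>] \<eta> by (auto simp: dist_real_def b_eq param_dom_def)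
    \<comment> \<open>In the chart at \<open>crit n\<close> the points over \<open>a\<close> have
      coordinates with the same square. Those of \<open>u \<sigma>\<close> and
      \<open>l \<sigma>\<close> differ, so they are opposite.\<close>
    have fold: "h1 (l \<sigma>) = - h1 (u \<sigma>)"
    proof -
      have "(h1 (l \<sigma>))\<^sup>2 = (h1 (u \<sigma>))\<^sup>2" using U(10) uU lU by (metis add_left_cancel)
      moreover have "h1 (l \<sigma>) \<noteq> h1 (u \<sigma>)"
        using U(9) uU(1) lU(1) ul(11)[of \<sigma>] \<sigma>(1) by (metis greaterThanLessThan_iff atLeastLessThan_iff less_imp_le)
      ultimately show ?thesis by (simp add: power2_eq_iff)
    qed

    \<comment> \<open>The end of the way back and the target branch both have an \<open>n\<close>-th
      root of \<open>b\<close> as coordinate in the chart at \<open>0\<close>. The root of unity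
      between them prescribes the number \<open>k\<close> of turns.\<close>
    have "h0 (l \<eta>) ^ n = b" "h0 (l \<eta>) \<noteq> 0"
      using U(5)[OF lU0(1)] U(4)[OF lU0(1)] U(4)[OF U(2)] U(6) lU0(2,3) by auto
    then have "h0 (l \<eta>) ^ n = slit_root p n i b ^ n"
      using slit_root_power[OF assms(1) p(1) \<open>b \<noteq> 0\<close>] by simp
    then obtain k where k: "k \<ge> 1"
      "slit_root p n i b = h0 (l \<eta>) * exp (2 * of_real pi * \<i> * of_nat k / of_nat n)"
      using root_quotient_turns[OF assms(1) _ \<open>h0 (l \<eta>) \<noteq> 0\<close>] by metis

    \<comment> \<open>The lift follows \<open>u\<close> from \<open>1\<close>, makes half a turn in
      the coordinate \<open>h1\<close>, follows \<open>l\<close> towards \<open>0\<close>, and makes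
      \<open>k / n\<close> of a turn in the coordinate \<open>h0\<close>.\<close>
    define \<tau>1 where "\<tau>1 = u \<circ> linepath 0 \<sigma>"
    define \<tau>2 where "\<tau>2 s = g1 (h1 (u \<sigma>) * exp (2 * of_real pi * \<i> * of_nat 1 * of_real s / of_nat 2))" for s :: real
    define \<tau>3 where "\<tau>3 = l \<circ> linepath \<sigma> \<eta>"
    define \<tau>4 where "\<tau>4 s = g0 (h0 (l \<eta>) * exp (2 * of_real pi * \<i> * of_nat k * of_real s / of_nat n))" for s :: real
    have lift1: "lifts (param_x n y0) (param_dom n) (linepath 0 a) \<tau>1"
      using lifts_linepath[OF ul(1,7), of "{0..<1}" "param_dom n" 0 \<sigma>] ul(9) \<sigma>(1)
      by (simp add: \<tau>1_def a_def convex_real_interval subset_iff)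
    have lift2: "lifts (param_x n y0) (param_dom n) (turns p a 1) \<tau>2"
      unfolding \<tau>2_def by (rule lifts_turns[OF chart1(1) _ chart1(2) uU]) simp
    have lift3: "lifts (param_x n y0) (param_dom n) (linepath a b) \<tau>3"
      using lifts_linepath[OF ul(2,8), of "{0<..<1}" "param_dom n" \<sigma> \<eta>] ul(10) \<sigma>(1) \<eta>(1)
      by (simp add: \<tau>3_def a_def b_eq convex_real_interval subset_iff)
    have lift4: "lifts (param_x n y0) (param_dom n) (turns 0 b k) \<tau>4"
      unfolding \<tau>4_def by (rule lifts_turns[OF chart0(1) _ chart0(2) lU0]) (use assms(1) in simp)
    \<comment> \<open>The half turn multiplies \<open>h1 (u \<sigma>)\<close> by -1, which is
      \<open>h1 (l \<sigma>)\<close> by \<open>fold\<close>: here the lift changes from one sheet to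
      the other.\<close>
    have join: "pathfinish \<tau>1 = pathstart \<tau>2" "pathfinish \<tau>2 = pathstart \<tau>3" "pathfinish \<tau>3 = pathstart \<tau>4"
      using U(4,9) uU(1) lU(1) lU0(1)
      by (auto simp: \<tau>1_def \<tau>2_def \<tau>3_def \<tau>4_def pathstart_def pathfinish_def linepath_def
          mult.commute[of _ \<i>] simp flip: fold)
    have lift: "lifts (param_x n y0) (param_dom n) (omega p \<rho> \<epsilon> +++ turns 0 b k)
        ((\<tau>1 +++ (\<tau>2 +++ \<tau>3)) +++ \<tau>4)"
      unfolding omega_def Let_def a_eq b_def[symmetric]
      by (intro lifts_join lift1 lift2 lift3 lift4) (simp_all add: join)
    have "exp (2 * of_real pi * \<i> * of_nat k) = (1 :: complex)"
      using complex_root_unity_eq_1[of 1 k] by simp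
    then have fin: "pathfinish (omega p \<rho> \<epsilon> +++ turns 0 b k) = b"
      by (simp add: pathfinish_def joinpaths_def turns_eq)
    have start: "pathstart (omega p \<rho> \<epsilon> +++ turns 0 b k) = 0"
      by (simp add: omega_def Let_def pathstart_join pathstart_linepath)
    have "continues_along (omega p \<rho> \<epsilon> +++ turns 0 b k) f (G i)"
    proof (rule continues_along_lift[OF param_x_holomorphic open_param_dom
          deriv_param_x_neq_0[OF assms(1,2)] param_y_holomorphic lift, unfolded start fin])
      show "isCont A 0" by (rule A_cont)
      show "A 0 = pathstart ((\<tau>1 +++ (\<tau>2 +++ \<tau>3)) +++ \<tau>4)"
        by (simp add: A0 pathstart_join) (simp add: \<tau>1_def pathstart_def linepath_def ul(3))
      have "\<forall>\<^sub>F z in nhds 0. z \<in> ball (0 :: complex) R"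
        using R(1) by (intro eventually_nhds_in_open) auto
      then show "\<forall>\<^sub>F z in nhds 0. param_x n y0 (A z) = z \<and> f z = param_y n y0 (A z)"
        by eventually_elim
          (simp add: A_def Hf param_x_param[OF assms(1,2)] param_y_param[OF assms(1,2)])
      note D = open_slit_disc[OF p(1)] \<open>b \<in> slit_disc p r\<close>
      show "isCont (B i) b"
        using holomorphic_on_imp_isCont[OF rem(4) D] by (simp add: B_def[abs_def])
      show "B i b = pathfinish ((\<tau>1 +++ (\<tau>2 +++ \<tau>3)) +++ \<tau>4)"
        by (simp add: pathfinish_join) (simp add: B_def k(2) \<tau>4_def pathfinish_def)
      have "\<forall>\<^sub>F z in nhds b. z \<in> slit_disc p r"
        using D by (rule eventually_nhds_in_open)
      then show "\<forall>\<^sub>F z in nhds b. param_x n y0 (B i z) = z \<and> G i z = param_y n y0 (B i z)"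
        by eventually_elim (simp add: B_def G_def rem(3))
    qed
    with k(1) show ?thesis unfolding b_def by blast
  qed
  with \<open>r > 0\<close> remG show ?thesis by blast
qed

theorem theorem6p1:
  fixes n :: nat and y0 :: complex
  assumes "n \<ge> 1" and "y0 \<noteq> 0"
  shows "irreducible_algebraic_set (solution_curve n y0) \<and>
    (\<forall>S g. open S \<and> branch n y0 S g \<longrightarrow> satisfies_ode n S g) \<and>
    (\<exists>f. local_solution n y0 f) \<and>
    (\<forall>f. local_solution n y0 f \<longrightarrow>
      (\<exists>r>0. \<exists>G. remaining_branches n y0 f (slit_disc (sing_point n y0) r) G \<and>
        (\<forall>\<rho> \<epsilon>. 0 < \<rho> \<and> \<rho> < r \<and> 0 < \<epsilon> \<and> \<epsilon> < r \<longrightarrow>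
          (\<forall>i<n. \<exists>k\<ge>1. continues_along
            (omega (sing_point n y0) \<rho> \<epsilon> +++ turns 0 (base_point (sing_point n y0) \<epsilon>) k)
            f (G i)))))"
  using irreducible_solution_curve[OF assms] branch_satisfies_ode[OF assms]
    local_solution_exists[OF assms] continuation_of_local_solution[OF assms]
  by blast

end
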